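(* Let $W,V>1$, $M\ge 1$ and $r\in(0,1]$. Algorithm SA (described in the context) with admittance probability $r$, using $\ell_W$ work-classes with maximal within-class ratio $\delta_W$ and $\ell_V$ profit-classes with maximal within-class ratio $\delta_V$, is $$O\left(\left[\frac{M}{r}+\delta_W\cdot\delta_V\right]\cdot\ell_W\cdot\ell_V\right)\text{-competitive},$$ i.e. there is a universal constant $C$ such that for every finite arrival sequence with at most $M$ unknown packets per cycle, the throughput of any offline algorithm is at most $C\left[\frac{M}{r}+\delta_W\delta_V\right]\ell_W\ell_V$ times the expected throughput of SA.
   Context: Model. Time is divided into discrete cycles, each consisting of three steps: (i) transmission: fully processed packets leave the queue; (ii) arrival: new packets may arrive one after the other, and the algorithm decides which to accept and which currently buffered packets to push out and drop; (iii) processing: a single buffered packet receives one processing cycle. The buffer (of the online and of the offline algorithm) holds at most $B\ge 2$ packets. Packets have unit size; packet $p$ has profit $v(p)\in\{1,\dots,V\}$ (gained when transmitted) and work $w(p)\in\{1,\dots,W\}$ (number of processing cycles needed before transmission). On arrival the characteristics $(w(p),v(p))$ are either known (a $K$-packet) or unknown (a $U$-packet); those of a $U$-packet become known once it undergoes its first processing cycle ("parsing"), which counts as one of its $w(p)$ cycles. At most $M$ $U$-packets arrive per cycle. Throughput is the total profit of all packets eventually transmitted. Offline algorithms know the whole arrival sequence and all characteristics. Classes. The set $\{1,\dots,W\}$ of work values is partitioned into $\ell_W$ work-classes and the set $\{1,\dots,V\}$ of profit values into $\ell_V$ profit-classes; $\delta_W$ (resp. $\delta_V$) is the maximal ratio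 between two work (resp. profit) values in the same class. A packet is in combined class $C_{(i,j)}$ if its total work $w(p)$ (not the remaining work) is in work-class $i$ and its profit is in profit-class $j$. Algorithm SA. At initialization pick $i^*\in\{1,\dots,\ell_W\}$ and $j^*\in\{1,\dots,\ell_V\}$ independently and uniformly at random; the selected class is $G=C_{(i^*,j^* )}$. A $G^K$-packet is a packet in $G$ whose characteristics are currently known. The buffer is Gfull if it contains $B$ $G^K$-packets. Priority order of buffered packets: the admitted packet (if any) first, then $G^K$-packets, then all other packets; ties are broken by FIFO. "Making room" means: if the buffer is full, drop the lowest-priority packet. A variable phase (initially fill) is updated as follows: set to fill if the buffer is empty, to flush if the buffer is Gfull, otherwise left unchanged. In each cycle, after transmission: (1) update phase; (2) independently declare the cycle an admittance cycle with probability $r$; (3) while phase is fill and there is a further arriving packet $p$: (a) if $p$ is a $G^K$-packet: if the buffer contains $B-1$ $G^K$-packets, drop the admitted packet if one exists; then make room and accept $p$; (b) if $p$ is a $U$-packet and the cycle is an admittance cycle: if $p$ is the first $U$-packet of this cycle, make room, accept $p$ and mark it admitted; if it is the $m$-th one, $m\ge2$, then with probability $1/m$ replace the admitted packet by $p$ (which becomes the admitted packet); (c) if $p$ has not been accepted and the buffer is not full, accept $p$; then update phase. Packets arriving while phase is flush are discarded. (4) In the processing step, process the highest-priority buffered packet for one cycle; the mark "admitted" is then removed; update phase. *)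

theory Defs
  imports "HOL-Probability.Probability"
begin

record packet =
  work :: nat
  profit :: nat
  known :: bool  \<comment> \<open>\<open>K\<close>-packet if true, \<open>U\<close>-packet if false\<close>

text \<open>An arrival sequence lists, cycle by cycle, the packets arriving in that cycle, in order of
  arrival. The system keeps running after the last listed cycle.\<close>

type_synonym arrivals = "packet list list"

definition arrivals_at :: "arrivals \<Rightarrow> nat \<Rightarrow> packet list" where
  "arrivals_at \<sigma> n = (if n < length \<sigma> then \<sigma> ! n else [])"

definition valid_arrivals :: "nat \<Rightarrow> nat \<Rightarrow> nat \<Rightarrow> arrivals \<Rightarrow> bool" where
  "valid_arrivals W V M \<sigma> \<longleftrightarrow>
     (\<forall>ps \<in> set \<sigma>. (\<forall>p \<in> set ps. work p \<in> {1..W} \<and> profit p \<in> {1..V})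
        \<and> length (filter (\<lambda>p. \<not> known p) ps) \<le> M)"

text \<open>A buffered packet is paired with its remaining work. An offline state pairs the buffer with
  the total profit of the packets transmitted so far. Schedules may idle and may push out any
  packets whenever a new one arrives.\<close>

type_synonym offline_buffer = "(packet \<times> nat) multiset"

inductive offline_arrivals ::
  "nat \<Rightarrow> packet list \<Rightarrow> offline_buffer \<Rightarrow> offline_buffer \<Rightarrow> bool" for B :: nat where
  offline_Nil: "offline_arrivals B [] b b"
| offline_Cons: "\<lbrakk>b' \<subseteq># add_mset (p, work p) b; size b' \<le> B; offline_arrivals B ps b' b''\<rbrakk>
    \<Longrightarrow> offline_arrivals B (p # ps) b b''"

inductive offline_process :: "offline_buffer \<Rightarrow> offline_buffer \<Rightarrow> bool" where
  offline_idle: "offline_process b b"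
| offline_work: "offline_process (add_mset (p, Suc k) b) (add_mset (p, k) b)"

inductive offline_cycle ::
  "nat \<Rightarrow> packet list \<Rightarrow> offline_buffer \<times> nat \<Rightarrow> offline_buffer \<times> nat \<Rightarrow> bool" for B :: nat where
  "\<lbrakk>offline_arrivals B ps (filter_mset (\<lambda>(p, k). k > 0) b) b'; offline_process b' b''\<rbrakk>
    \<Longrightarrow> offline_cycle B ps (b, g)
          (b'', g + (\<Sum>(p, k) \<in># filter_mset (\<lambda>(p, k). k = 0) b. profit p))"

definition offline_schedule :: "nat \<Rightarrow> arrivals \<Rightarrow> (nat \<Rightarrow> offline_buffer \<times> nat) \<Rightarrow> bool" where
  "offline_schedule B \<sigma> S \<longleftrightarrow>
     S 0 = ({#}, 0) \<and> (\<forall>n. offline_cycle B (arrivals_at \<sigma> n) (S n) (S (Suc n)))"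

text \<open>The gained profit is nondecreasing in the number of cycles and bounded by the total profit
  of all arriving packets, so the following suprema are limits of convergent real sequences.\<close>

definition offline_throughput :: "(nat \<Rightarrow> offline_buffer \<times> nat) \<Rightarrow> real" where
  "offline_throughput S = (SUP n. real (snd (S n)))"

text \<open>\<open>alg\<close> maps an arrival sequence to the (expected) throughput of the online algorithm with
  buffer size \<open>B\<close>.\<close>

definition competitive ::
  "nat \<Rightarrow> nat \<Rightarrow> nat \<Rightarrow> nat \<Rightarrow> (arrivals \<Rightarrow> real) \<Rightarrow> real \<Rightarrow> bool" where
  "competitive B W V M alg c \<longleftrightarrow>
     (\<forall>\<sigma> S. valid_arrivals W V M \<sigma> \<and> offline_schedule B \<sigma> S
        \<longrightarrow> offline_throughput S \<le> c * alg \<sigma>)"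

text \<open>The work-classes (profit-classes) are the blocks of a partition of \<open>{1..W}\<close> (of \<open>{1..V}\<close>).
  A combined class is given by a work-class and a profit-class.\<close>

type_synonym combined_class = "nat set \<times> nat set"

definition in_class :: "combined_class \<Rightarrow> packet \<Rightarrow> bool" where
  "in_class G p \<longleftrightarrow> work p \<in> fst G \<and> profit p \<in> snd G"

definition max_ratio :: "nat set set \<Rightarrow> real" where
  "max_ratio P = Max {real x / real y | x y A. A \<in> P \<and> x \<in> A \<and> y \<in> A}"

record buffered =
  pkt :: packet
  remaining :: nat
  admitted :: bool

datatype phase = Fill | Flush

text \<open>The buffer is kept in order of arrival, oldest packet first.\<close>

type_synonym sa_buffer = "buffered list"

record sa_state =
  buffer :: sa_buffer
  phase :: phase
  gained :: nat

definition fresh :: "packet \<Rightarrow> bool \<Rightarrow> buffered" where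
  "fresh p adm = \<lparr>pkt = p, remaining = work p, admitted = adm\<rparr>"

text \<open>A \<open>U\<close>-packet is known from its first processing cycle on, i.e. as soon as its remaining
  work differs from its total work.\<close>

definition is_GK :: "combined_class \<Rightarrow> buffered \<Rightarrow> bool" where
  "is_GK G x \<longleftrightarrow> in_class G (pkt x) \<and> (known (pkt x) \<or> remaining x < work (pkt x))"

definition num_GK :: "combined_class \<Rightarrow> sa_buffer \<Rightarrow> nat" where
  "num_GK G b = length (filter (is_GK G) b)"

definition update_phase :: "nat \<Rightarrow> combined_class \<Rightarrow> sa_buffer \<Rightarrow> phase \<Rightarrow> phase" where
  "update_phase B G b ph =
     (if b = [] then Fill else if num_GK G b = B then Flush else ph)"

text \<open>Smaller rank means higher priority; among equal ranks, the earlier position wins.\<close>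

definition rank :: "combined_class \<Rightarrow> buffered \<Rightarrow> nat" where
  "rank G x = (if admitted x then 0 else if is_GK G x then 1 else 2)"

definition highest_index :: "combined_class \<Rightarrow> sa_buffer \<Rightarrow> nat" where
  "highest_index G b =
     (LEAST i. i < length b \<and> (\<forall>j < length b. rank G (b ! i) \<le> rank G (b ! j)))"

definition lowest_index :: "combined_class \<Rightarrow> sa_buffer \<Rightarrow> nat" where
  "lowest_index G b =
     (GREATEST i. i < length b \<and> (\<forall>j < length b. rank G (b ! j) \<le> rank G (b ! i)))"

definition make_room :: "nat \<Rightarrow> combined_class \<Rightarrow> sa_buffer \<Rightarrow> sa_buffer" where
  "make_room B G b =
     (if length b < B then b
      else take (lowest_index G b) b @ drop (Suc (lowest_index G b)) b)"

definition drop_admitted :: "sa_buffer \<Rightarrow> sa_buffer" where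
  "drop_admitted b = filter (\<lambda>x. \<not> admitted x) b"

definition accept_if_room :: "nat \<Rightarrow> packet \<Rightarrow> sa_buffer \<Rightarrow> sa_buffer" where
  "accept_if_room B p b = (if length b < B then b @ [fresh p False] else b)"

text \<open>Treatment of one arriving packet in phase \<open>Fill\<close>. \<open>adm\<close> tells whether the cycle is an
  admittance cycle; if the packet is a \<open>U\<close>-packet, it is the \<open>m\<close>-th one of the cycle.\<close>

definition SA_arrival ::
  "nat \<Rightarrow> combined_class \<Rightarrow> bool \<Rightarrow> nat \<Rightarrow> packet \<Rightarrow> sa_buffer \<Rightarrow> sa_buffer pmf" where
  "SA_arrival B G adm m p b =
     (if known p \<and> in_class G p then
        return_pmf
          (make_room B G (if num_GK G b = B - 1 then drop_admitted b else b) @ [fresh p False])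
      else if \<not> known p \<and> adm then
        (if m = 1 then return_pmf (make_room B G b @ [fresh p True])
         else map_pmf
           (\<lambda>replace. if replace then drop_admitted b @ [fresh p True] else accept_if_room B p b)
           (bernoulli_pmf (1 / real m)))
      else return_pmf (accept_if_room B p b))"

text \<open>\<open>u\<close> counts the \<open>U\<close>-packets that have already arrived in the current cycle.\<close>

fun SA_arrivals ::
  "nat \<Rightarrow> combined_class \<Rightarrow> bool \<Rightarrow> nat \<Rightarrow> packet list \<Rightarrow> sa_buffer \<times> phase
     \<Rightarrow> (sa_buffer \<times> phase) pmf" where
  "SA_arrivals B G adm u [] (b, ph) = return_pmf (b, ph)"
| "SA_arrivals B G adm u (p # ps) (b, ph) =
     (if ph = Flush then return_pmf (b, ph)
      else bind_pmf (SA_arrival B G adm (Suc u) p b)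
        (\<lambda>b'. SA_arrivals B G adm (if known p then u else Suc u) ps
                (b', update_phase B G b' ph)))"

definition SA_process :: "combined_class \<Rightarrow> sa_buffer \<Rightarrow> sa_buffer" where
  "SA_process G b =
     (if b = [] then []
      else let i = highest_index G b
           in map (admitted_update (\<lambda>_. False)) (b[i := remaining_update (\<lambda>k. k - 1) (b ! i)]))"

definition SA_cycle ::
  "nat \<Rightarrow> real \<Rightarrow> combined_class \<Rightarrow> packet list \<Rightarrow> sa_state \<Rightarrow> sa_state pmf" where
  "SA_cycle B r G ps s =
     (let b = filter (\<lambda>x. remaining x > 0) (buffer s);
          g = gained s
                + sum_list (map (profit \<circ> pkt) (filter (\<lambda>x. remaining x = 0) (buffer s)));
          ph = update_phase B G b (phase s)
      in do {
        adm \<leftarrow> bernoulli_pmf r;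
        (b', ph') \<leftarrow> SA_arrivals B G adm 0 ps (b, ph);
        let b'' = SA_process G b';
        return_pmf \<lparr>buffer = b'', phase = update_phase B G b'' ph', gained = g\<rparr>
      })"

primrec SA_run ::
  "nat \<Rightarrow> real \<Rightarrow> combined_class \<Rightarrow> arrivals \<Rightarrow> nat \<Rightarrow> sa_state pmf" where
  "SA_run B r G \<sigma> 0 = return_pmf \<lparr>buffer = [], phase = Fill, gained = 0\<rparr>"
| "SA_run B r G \<sigma> (Suc n) = bind_pmf (SA_run B r G \<sigma> n) (SA_cycle B r G (arrivals_at \<sigma> n))"

definition SA ::
  "nat \<Rightarrow> real \<Rightarrow> nat set set \<Rightarrow> nat set set \<Rightarrow> arrivals \<Rightarrow> nat \<Rightarrow> sa_state pmf" where
  "SA B r PW PV \<sigma> n =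
     bind_pmf (pair_pmf (pmf_of_set PW) (pmf_of_set PV)) (\<lambda>G. SA_run B r G \<sigma> n)"

definition SA_throughput ::
  "nat \<Rightarrow> real \<Rightarrow> nat set set \<Rightarrow> nat set set \<Rightarrow> arrivals \<Rightarrow> real" where
  "SA_throughput B r PW PV \<sigma> =
     (SUP n. measure_pmf.expectation (SA B r PW PV \<sigma> n) (\<lambda>s. real (gained s)))"

end

theory Submission
  imports Defs
begin

text \<open>Fix a combined class \<open>G\<close>; it suffices to bound the offline profit from \<open>G\<close> by the
  expected profit of the run that selects \<open>G\<close>, since each class is selected with probability
  \<open>1 / (\<ell>\<^sub>W \<cdot> \<ell>\<^sub>V)\<close>. While filling, the algorithm never loses a \<open>G\<^sup>K\<close>-packet. In a cycle whose
  arrivals do not end in a flush, every arriving \<open>K\<close>-packet of \<open>G\<close> is therefore secured, and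
  every arriving \<open>U\<close>-packet of \<open>G\<close> is admitted, and hence secured, with probability at least
  \<open>r / M\<close>. The offline profit from \<open>G\<close>-packets arriving in the other cycles is charged to the
  \<open>B\<close> packets of \<open>G\<close> that are in the buffer when the flush starts: during the flush, whose
  length is at most \<open>B\<close> times the largest work in \<open>G\<close>, an offline schedule can complete
  \<open>O(B \<cdot> \<delta>\<^sub>W)\<close> packets of \<open>G\<close>, and it keeps at most \<open>B\<close> of them. Both arguments are combined
  into a potential that does not decrease in expectation.\<close>

subsection \<open>Buffer operations\<close>

text \<open>The packets that making room spares as long as they occupy fewer than \<open>B\<close>
  slots. Equality of \<open>kept\<close> transfers four quantities at once, see
  \<open>kept_cong\<close>.\<close>

definition kept :: "combined_class \<Rightarrow> sa_buffer \<Rightarrow> sa_buffer" where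
  "kept G b = filter (\<lambda>x. admitted x \<or> is_GK G x) b"

definition num_admitted :: "sa_buffer \<Rightarrow> nat" where
  "num_admitted b = length (filter admitted b)"

definition GK_profit :: "combined_class \<Rightarrow> sa_buffer \<Rightarrow> real" where
  "GK_profit G b = (\<Sum>x\<leftarrow>b. if is_GK G x then real (profit (pkt x)) else 0)"

definition admitted_profit :: "combined_class \<Rightarrow> sa_buffer \<Rightarrow> real" where
  "admitted_profit G b =
     (\<Sum>x\<leftarrow>b. if admitted x \<and> in_class G (pkt x) then real (profit (pkt x)) else 0)"

text \<open>Each cycle of a running flush lowers this by one, so it measures how long the flush
  still lasts.\<close>

definition residual :: "sa_buffer \<Rightarrow> nat" where
  "residual b = (\<Sum>x\<leftarrow>b. remaining x)"

definition packet_ok :: "nat \<Rightarrow> combined_class \<Rightarrow> buffered \<Rightarrow> bool" where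
  "packet_ok W G x \<longleftrightarrow> 0 < remaining x \<and> remaining x \<le> work (pkt x) \<and> work (pkt x) \<le> W
     \<and> (admitted x \<longrightarrow> \<not> is_GK G x)"

lemma GK_profit_simps [simp]:
  "GK_profit G [] = 0"
  "GK_profit G (x # b) = (if is_GK G x then real (profit (pkt x)) else 0) + GK_profit G b"
  "GK_profit G (b @ b') = GK_profit G b + GK_profit G b'"
  by (auto simp: GK_profit_def)

lemma admitted_profit_simps [simp]:
  "admitted_profit G [] = 0"
  "admitted_profit G (x # b) =
     (if admitted x \<and> in_class G (pkt x) then real (profit (pkt x)) else 0) + admitted_profit G b"
  "admitted_profit G (b @ b') = admitted_profit G b + admitted_profit G b'"
  by (auto simp: admitted_profit_def)

lemma residual_simps [simp]:
  "residual [] = 0" "residual (x # b) = remaining x + residual b"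
  "residual (b @ b') = residual b + residual b'"
  by (auto simp: residual_def)

lemma num_GK_simps [simp]:
  "num_GK G [] = 0" "num_GK G (x # b) = (if is_GK G x then 1 else 0) + num_GK G b"
  "num_GK G (b @ b') = num_GK G b + num_GK G b'"
  by (auto simp: num_GK_def)

lemma num_admitted_simps [simp]:
  "num_admitted [] = 0" "num_admitted (x # b) = (if admitted x then 1 else 0) + num_admitted b"
  "num_admitted (b @ b') = num_admitted b + num_admitted b'"
  by (auto simp: num_admitted_def)

lemma GK_profit_nonneg: "0 \<le> GK_profit G b"
  by (induction b) auto

lemma admitted_profit_nonneg: "0 \<le> admitted_profit G b"
  by (induction b) auto

lemma num_GK_le_length: "num_GK G b \<le> length b"
  by (simp add: num_GK_def)

lemma all_GK_if_num_GK: "num_GK G b = length b \<Longrightarrow> x \<in> set b \<Longrightarrow> is_GK G x"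
  unfolding num_GK_def by (metis filter_id_conv length_filter_less less_irrefl)

lemma num_admitted_eq_0: "num_admitted b = 0 \<longleftrightarrow> (\<forall>x\<in>set b. \<not> admitted x)"
  by (auto simp: num_admitted_def filter_empty_conv)

lemma admitted_profit_eq_0: "num_admitted b = 0 \<Longrightarrow> admitted_profit G b = 0"
  by (induction b) auto

lemma kept_functions:
  "num_GK G (kept G b) = num_GK G b" "num_admitted (kept G b) = num_admitted b"
  "GK_profit G (kept G b) = GK_profit G b" "admitted_profit G (kept G b) = admitted_profit G b"
  by (induction b) (auto simp: kept_def)

lemma kept_cong:
  assumes "kept G b = kept G b'"
  shows "num_GK G b = num_GK G b'" "num_admitted b = num_admitted b'"
    "GK_profit G b = GK_profit G b'" "admitted_profit G b = admitted_profit G b'"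
  using assms by (metis kept_functions)+

lemma exists_not_kept:
  assumes "num_GK G b + num_admitted b < length b"
  shows "\<exists>x\<in>set b. \<not> admitted x \<and> \<not> is_GK G x"
  using assms by (induction b) (auto split: if_splits)

section \<open>Extremal priorities and making room\<close>

lemma highest_index_props:
  assumes "b \<noteq> []"
  shows "highest_index G b < length b"
    and "\<forall>j < length b. rank G (b ! highest_index G b) \<le> rank G (b ! j)"
proof -
  have "\<exists>i. i < length b \<and> (\<forall>j < length b. rank G (b ! i) \<le> rank G (b ! j))"
    using assms ex_min_if_finite[of "(\<lambda>i. rank G (b ! i)) ` {..<length b}"]
    by (fastforce simp: not_less)
  from LeastI_ex[OF this] show "highest_index G b < length b"
    and "\<forall>j < length b. rank G (b ! highest_index G b) \<le> rank G (b ! j)"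
    unfolding highest_index_def by blast+
qed

lemma lowest_index_props:
  assumes "b \<noteq> []"
  shows "lowest_index G b < length b"
    and "\<forall>j < length b. rank G (b ! j) \<le> rank G (b ! lowest_index G b)"
proof -
  have "\<exists>i. i < length b \<and> (\<forall>j < length b. rank G (b ! j) \<le> rank G (b ! i))"
    using assms Max_in[of "(\<lambda>i. rank G (b ! i)) ` {..<length b}"]
      Max_ge[of "(\<lambda>i. rank G (b ! i)) ` {..<length b}"] by fastforce
  from GreatestI_ex_nat[OF this, of "length b"] show "lowest_index G b < length b"
    and "\<forall>j < length b. rank G (b ! j) \<le> rank G (b ! lowest_index G b)"
    unfolding lowest_index_def by auto
qed

lemma make_room_split:
  assumes "b \<noteq> []" "\<not> length b < B"
  obtains l x r where "b = l @ x # r" "make_room B G b = l @ r"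
    "\<And>y. y \<in> set b \<Longrightarrow> rank G y \<le> rank G x"
proof
  let ?i = "lowest_index G b"
  show "b = take ?i b @ b ! ?i # drop (Suc ?i) b"
    using lowest_index_props[OF assms(1)] by (simp add: id_take_nth_drop)
  show "make_room B G b = take ?i b @ drop (Suc ?i) b"
    using assms by (simp add: make_room_def)
  show "rank G y \<le> rank G (b ! ?i)" if "y \<in> set b" for y
    using lowest_index_props[OF assms(1)] that by (metis in_set_conv_nth)
qed

lemma make_room_kept:
  assumes "length b \<le> B" "num_GK G b + num_admitted b < B"
  shows "kept G (make_room B G b) = kept G b" "length (make_room B G b) < B"
    "set (make_room B G b) \<subseteq> set b"
proof -
  have "kept G (make_room B G b) = kept G b \<and> length (make_room B G b) < B
    \<and> set (make_room B G b) \<subseteq> set b"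
  proof (cases "length b < B")
    case True
    then show ?thesis by (simp add: make_room_def)
  next
    case False
    then have "b \<noteq> []" using assms by auto
    then obtain l x r where s: "b = l @ x # r" "make_room B G b = l @ r"
      "\<And>y. y \<in> set b \<Longrightarrow> rank G y \<le> rank G x"
      using make_room_split False by metis
    obtain y where "y \<in> set b" "\<not> admitted y" "\<not> is_GK G y"
      using exists_not_kept[of G b] assms False by auto
    then have "\<not> admitted x" "\<not> is_GK G x"
      using s(3)[of y] by (auto simp: rank_def split: if_splits)
    then show ?thesis using s(1,2) assms by (auto simp: kept_def)
  qed
  then show "kept G (make_room B G b) = kept G b" "length (make_room B G b) < B"
    "set (make_room B G b) \<subseteq> set b" by auto
qed

lemma drop_admitted_props:
  assumes "\<forall>x\<in>set b. admitted x \<longrightarrow> \<not> is_GK G x"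
  shows "num_GK G (drop_admitted b) = num_GK G b" "num_admitted (drop_admitted b) = 0"
    "GK_profit G (drop_admitted b) = GK_profit G b"
    "length (drop_admitted b) = length b - num_admitted b"
    "set (drop_admitted b) \<subseteq> set b"
proof -
  show "num_GK G (drop_admitted b) = num_GK G b" "num_admitted (drop_admitted b) = 0"
    "GK_profit G (drop_admitted b) = GK_profit G b" "set (drop_admitted b) \<subseteq> set b"
    using assms by (induction b) (auto simp: drop_admitted_def)
  show "length (drop_admitted b) = length b - num_admitted b"
    using sum_length_filter_compl[of admitted b] by (simp add: drop_admitted_def num_admitted_def)
qed

lemma is_GK_fresh [simp]: "is_GK G (fresh p a) \<longleftrightarrow> known p \<and> in_class G p"
  by (auto simp: is_GK_def fresh_def)

lemma fresh_simps [simp]: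
  "pkt (fresh p a) = p" "remaining (fresh p a) = work p" "admitted (fresh p a) = a"
  by (auto simp: fresh_def)

lemma packet_ok_fresh:
  "0 < work p \<Longrightarrow> work p \<le> W \<Longrightarrow> (a \<Longrightarrow> \<not> known p) \<Longrightarrow> packet_ok W G (fresh p a)"
  by (auto simp: packet_ok_def)

subsection \<open>Arrivals while the algorithm is filling its buffer\<close>

definition filling ::
  "nat \<Rightarrow> nat \<Rightarrow> combined_class \<Rightarrow> bool \<Rightarrow> nat \<Rightarrow> sa_buffer \<Rightarrow> bool" where
  "filling B W G adm u b \<longleftrightarrow> length b \<le> B \<and> num_GK G b < B \<and> (\<forall>x\<in>set b. packet_ok W G x)
     \<and> num_admitted b = (if adm \<and> 0 < u then 1 else 0)"

definition gfull :: "nat \<Rightarrow> nat \<Rightarrow> combined_class \<Rightarrow> sa_buffer \<Rightarrow> bool" where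
  "gfull B W G b \<longleftrightarrow> length b = B \<and> num_GK G b = B \<and> (\<forall>x\<in>set b. packet_ok W G x)"

definition K_packets :: "combined_class \<Rightarrow> packet list \<Rightarrow> packet list" where
  "K_packets G ps = filter (\<lambda>p. known p \<and> in_class G p) ps"

definition U_packets :: "combined_class \<Rightarrow> packet list \<Rightarrow> packet list" where
  "U_packets G ps = filter (\<lambda>p. \<not> known p \<and> in_class G p) ps"

definition total_profit :: "packet list \<Rightarrow> real" where
  "total_profit ps = (\<Sum>p\<leftarrow>ps. real (profit p))"

lemma K_packets_simps [simp]:
  "K_packets G [] = []"
  "K_packets G (p # ps) = (if known p \<and> in_class G p then p # K_packets G ps else K_packets G ps)"
  by (auto simp: K_packets_def)

lemma U_packets_simps [simp]:
  "U_packets G [] = []"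
  "U_packets G (p # ps) =
     (if \<not> known p \<and> in_class G p then p # U_packets G ps else U_packets G ps)"
  by (auto simp: U_packets_def)

lemma total_profit_simps [simp]:
  "total_profit [] = 0" "total_profit (p # ps) = real (profit p) + total_profit ps"
  by (auto simp: total_profit_def)

lemma total_profit_nonneg: "0 \<le> total_profit ps"
  by (induction ps) auto

lemma filling_GK_add_admitted:
  assumes "2 \<le> B" "filling B W G adm u b" "num_GK G b < B - 1 \<or> u = 0"
  shows "num_GK G b + num_admitted b < B"
  using assms by (auto simp: filling_def)

lemma SA_arrival_filling:
  assumes B: "2 \<le> B" and fill: "filling B W G adm u b" and w: "0 < work p" "work p \<le> W"
    and not_full: "\<not> (known p \<and> in_class G p \<and> num_GK G b = B - 1)"
    and b': "b' \<in> set_pmf (SA_arrival B G adm (Suc u) p b)"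
  shows "filling B W G adm (if known p then u else Suc u) b'"
    "num_GK G b' = num_GK G b + length (K_packets G [p])"
    "GK_profit G b' = GK_profit G b + total_profit (K_packets G [p])"
proof -
  have ok: "\<forall>x\<in>set b. packet_ok W G x" and len: "length b \<le> B" and gk: "num_GK G b < B"
    using fill by (auto simp: filling_def)
  have adm_not_GK: "\<forall>x\<in>set b. admitted x \<longrightarrow> \<not> is_GK G x"
    using ok by (auto simp: packet_ok_def)
  note dr = drop_admitted_props[OF adm_not_GK]
  have aif: "filling B W G adm (if known p then u else Suc u) (accept_if_room B p b)
      \<and> num_GK G (accept_if_room B p b) = num_GK G b
      \<and> GK_profit G (accept_if_room B p b) = GK_profit G b"
    if "\<not> (known p \<and> in_class G p)" "known p \<or> \<not> adm \<or> 0 < u"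
    using that fill w by (auto simp: accept_if_room_def filling_def packet_ok_fresh)
  have "filling B W G adm (if known p then u else Suc u) b'
      \<and> num_GK G b' = num_GK G b + length (K_packets G [p])
      \<and> GK_profit G b' = GK_profit G b + total_profit (K_packets G [p])"
  proof (cases "known p \<and> in_class G p")
    case True
    with not_full gk have "num_GK G b < B - 1" by auto
    from make_room_kept[OF len filling_GK_add_admitted[OF B fill disjI1[OF this]]]
    have mr: "kept G (make_room B G b) = kept G b" "length (make_room B G b) < B"
      "set (make_room B G b) \<subseteq> set b" .
    have "b' = make_room B G b @ [fresh p False]"
      using b' True not_full by (simp add: SA_arrival_def)
    then show ?thesis
      using True mr kept_cong[OF mr(1)] \<open>num_GK G b < B - 1\<close> ok fill w
      by (auto simp: filling_def packet_ok_fresh)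
  next
    case not_GK: False
    show ?thesis
    proof (cases "\<not> known p \<and> adm")
      case False
      then have "b' = accept_if_room B p b" using b' not_GK by (auto simp: SA_arrival_def)
      then show ?thesis using aif False not_GK by auto
    next
      case U: True
      show ?thesis
      proof (cases "u = 0")
        case True
        from make_room_kept[OF len filling_GK_add_admitted[OF B fill disjI2[OF this]]]
        have mr: "kept G (make_room B G b) = kept G b" "length (make_room B G b) < B"
          "set (make_room B G b) \<subseteq> set b" .
        have "b' = make_room B G b @ [fresh p True]"
          using b' U True by (simp add: SA_arrival_def)
        then show ?thesis
          using U True mr kept_cong[OF mr(1)] ok fill w
          by (auto simp: filling_def packet_ok_fresh)
      next
        case False
        then have "b' = drop_admitted b @ [fresh p True] \<or> b' = accept_if_room B p b"
          using b' U by (auto simp: SA_arrival_def split: if_splits)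
        moreover have ok_drop: "\<forall>x\<in>set (drop_admitted b). packet_ok W G x"
          using dr(5) ok by blast
        moreover have "num_admitted b = 1" using fill U False by (auto simp: filling_def)
        ultimately show ?thesis
          using aif U False dr(1-4) ok_drop fill w len gk
          by (auto simp: filling_def packet_ok_fresh)
      qed
    qed
  qed
  then show "filling B W G adm (if known p then u else Suc u) b'"
    "num_GK G b' = num_GK G b + length (K_packets G [p])"
    "GK_profit G b' = GK_profit G b + total_profit (K_packets G [p])" by auto
qed

lemma SA_arrival_gfull:
  assumes B: "2 \<le> B" and fill: "filling B W G adm u b" and w: "0 < work p" "work p \<le> W"
    and full: "known p" "in_class G p" "num_GK G b = B - 1"
    and b': "b' \<in> set_pmf (SA_arrival B G adm (Suc u) p b)"
  shows "gfull B W G b'" "GK_profit G b \<le> GK_profit G b'"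
proof -
  have ok: "\<forall>x\<in>set b. packet_ok W G x" and len: "length b \<le> B" and gk: "num_GK G b < B"
    using fill by (auto simp: filling_def)
  have adm_not_GK: "\<forall>x\<in>set b. admitted x \<longrightarrow> \<not> is_GK G x"
    using ok by (auto simp: packet_ok_def)
  note dr = drop_admitted_props[OF adm_not_GK]
  let ?d = "make_room B G (drop_admitted b)"
  have mr: "kept G ?d = kept G (drop_admitted b)" "length ?d < B" "set ?d \<subseteq> set (drop_admitted b)"
    using make_room_kept[of "drop_admitted b" B G] dr len full B by auto
  have b'_eq: "b' = ?d @ [fresh p False]" using b' full by (simp add: SA_arrival_def)
  have n: "num_GK G ?d = B - 1" using kept_cong(1)[OF mr(1)] dr(1) full(3) by simp
  \<comment> \<open>The length is squeezed between the number of \<open>G^K\<close>-packets and the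
    strict bound from making room, so only \<open>G^K\<close>-packets are left.\<close>
  then have "length ?d = B - 1" using num_GK_le_length[of G ?d] mr(2) by simp
  then show "gfull B W G b'"
    using b'_eq n full B mr(3) dr(5) ok w by (auto simp: gfull_def packet_ok_fresh)
  show "GK_profit G b \<le> GK_profit G b'"
    using b'_eq kept_cong(3)[OF mr(1)] dr(3) by simp
qed

lemma update_phase_filling: "filling B W G adm u b \<Longrightarrow> update_phase B G b Fill = Fill"
  by (auto simp: update_phase_def filling_def)

lemma update_phase_gfull: "2 \<le> B \<Longrightarrow> gfull B W G b \<Longrightarrow> update_phase B G b ph = Flush"
  by (auto simp: update_phase_def gfull_def)

lemma SA_arrivals_Flush [simp]: "SA_arrivals B G adm u ps (b, Flush) = return_pmf (b, Flush)"
  by (cases ps) auto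

lemma finite_SA_arrival: "finite (set_pmf (SA_arrival B G adm m p b))"
  by (auto simp: SA_arrival_def)

lemma finite_SA_arrivals: "finite (set_pmf (SA_arrivals B G adm u ps s))"
proof (induction ps arbitrary: u s)
  case Nil
  then show ?case by (cases s) simp
next
  case (Cons p ps)
  then show ?case by (cases s) (auto simp: finite_SA_arrival)
qed

text \<open>The coin tosses of a cycle do not influence the number of \<open>G\<^sup>K\<close>-packets in the buffer, so
  whether the arrivals of a cycle trigger flushing is determined at the start of the cycle.\<close>

lemma SA_arrivals_outcome:
  assumes "2 \<le> B" "filling B W G adm u b" "\<forall>p\<in>set ps. 0 < work p \<and> work p \<le> W"
    and "(b', ph') \<in> set_pmf (SA_arrivals B G adm u ps (b, Fill))"
  shows "GK_profit G b \<le> GK_profit G b' \<and>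
    (if num_GK G b + length (K_packets G ps) < B
     then ph' = Fill \<and> (\<exists>u'. filling B W G adm u' b')
     else ph' = Flush \<and> gfull B W G b')"
  using assms
proof (induction ps arbitrary: u b)
  case Nil
  then show ?case by (auto simp: filling_def)
next
  case (Cons p ps)
  have w: "0 < work p" "work p \<le> W" using Cons.prems by auto
  let ?u = "if known p then u else Suc u"
  from Cons.prems(4) obtain b1 where b1: "b1 \<in> set_pmf (SA_arrival B G adm (Suc u) p b)"
    "(b', ph') \<in> set_pmf (SA_arrivals B G adm ?u ps (b1, update_phase B G b1 Fill))"
    by auto
  show ?case
  proof (cases "known p \<and> in_class G p \<and> num_GK G b = B - 1")
    case True
    from SA_arrival_gfull[OF Cons.prems(1,2) w _ _ _ b1(1)] True
    have "gfull B W G b1" "GK_profit G b \<le> GK_profit G b1" by auto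
    then show ?thesis using b1(2) True Cons.prems(1) by (auto simp: update_phase_gfull)
  next
    case False
    note f = SA_arrival_filling[OF Cons.prems(1,2) w False b1(1)]
    have "0 \<le> total_profit (K_packets G [p])" by (rule total_profit_nonneg)
    then have "GK_profit G b \<le> GK_profit G b1" using f(3) by linarith
    moreover have "length (K_packets G (p # ps)) = length (K_packets G [p]) + length (K_packets G ps)"
      by simp
    ultimately show ?thesis
      using Cons.IH[OF Cons.prems(1) f(1)] Cons.prems(3) b1(2) f(1,2)
      by (auto simp: update_phase_filling split: if_splits)
  qed
qed

subsection \<open>Lower bounds for expectations\<close>

text \<open>The law of total expectation as an inequality. Finite support turns the outer
  expectation into a finite sum, so no integrability question arises.\<close>

lemma expectation_bind_ge:
  fixes h :: "'b \<Rightarrow> real"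
  assumes "finite (set_pmf p)" "\<And>x. x \<in> set_pmf p \<Longrightarrow> finite (set_pmf (f x))"
    and "\<And>x. x \<in> set_pmf p \<Longrightarrow> g x \<le> measure_pmf.expectation (f x) h"
  shows "measure_pmf.expectation p g \<le> measure_pmf.expectation (bind_pmf p f) h"
proof -
  have "measure_pmf.expectation p g = (\<Sum>a\<in>set_pmf p. pmf p a * g a)"
    using assms(1) by (subst integral_measure_pmf[of "set_pmf p"]) auto
  also have "\<dots> \<le> (\<Sum>a\<in>set_pmf p. pmf p a * measure_pmf.expectation (f a) h)"
    using assms(3) by (intro sum_mono mult_left_mono) auto
  also have "\<dots> = measure_pmf.expectation (bind_pmf p f) h"
    using assms(1,2) by (subst pmf_expectation_bind[of "set_pmf p"]) auto
  finally show ?thesis .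
qed

lemma expectation_ge_const:
  fixes h :: "'a \<Rightarrow> real"
  assumes "finite (set_pmf p)" "\<And>x. x \<in> set_pmf p \<Longrightarrow> c \<le> h x"
  shows "c \<le> measure_pmf.expectation p h"
proof -
  have "measure_pmf.expectation p (\<lambda>_. c) \<le> measure_pmf.expectation p h"
    using assms by (intro integral_mono_AE integrable_measure_pmf_finite)
      (auto simp: AE_measure_pmf_iff)
  then show ?thesis by simp
qed

subsection \<open>Reservoir sampling\<close>

definition num_U :: "packet list \<Rightarrow> nat" where
  "num_U ps = length (filter (\<lambda>p. \<not> known p) ps)"

lemma num_U_simps [simp]:
  "num_U [] = 0" "num_U (p # ps) = (if known p then num_U ps else Suc (num_U ps))"
  by (auto simp: num_U_def)

lemma SA_arrival_admitted_profit:
  assumes B: "2 \<le> B" and fill: "filling B W G adm u b" and w: "0 < work p" "work p \<le> W"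
    and not_full: "\<not> (known p \<and> in_class G p \<and> num_GK G b = B - 1)"
    and b': "b' \<in> set_pmf (SA_arrival B G adm (Suc u) p b)"
    and "known p \<or> \<not> adm"
  shows "admitted_profit G b' = admitted_profit G b"
proof (cases "known p \<and> in_class G p")
  case True
  have len: "length b \<le> B" "num_GK G b < B - 1"
    using fill True not_full by (auto simp: filling_def)
  have "kept G (make_room B G b) = kept G b"
    using make_room_kept(1)[OF len(1) filling_GK_add_admitted[OF B fill]] len by auto
  then have "admitted_profit G (make_room B G b) = admitted_profit G b"
    by (rule kept_cong)
  then show ?thesis using b' True not_full by (auto simp: SA_arrival_def)
next
  case False
  then have "b' = accept_if_room B p b" using assms(7) b' by (auto simp: SA_arrival_def)
  then show ?thesis by (simp add: accept_if_room_def)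
qed

text \<open>After \<open>m\<close> \<open>U\<close>-packets of an admittance cycle, each of them is the admitted one with
  probability \<open>1/m\<close>; the term weighted with \<open>u\<close> stands for those that arrived before
  \<open>ps\<close>.\<close>

lemma reservoir_sampling:
  assumes "2 \<le> B" "filling B W G adm u b" "\<forall>p\<in>set ps. 0 < work p \<and> work p \<le> W"
    and "num_GK G b + length (K_packets G ps) < B"
  shows "GK_profit G b + total_profit (K_packets G ps) + (if adm then
      (real u * admitted_profit G b + total_profit (U_packets G ps)) / real (u + num_U ps) else 0)
    \<le> measure_pmf.expectation (SA_arrivals B G adm u ps (b, Fill))
        (\<lambda>x. GK_profit G (fst x) + admitted_profit G (fst x))"
  using assms
proof (induction ps arbitrary: u b)
  case Nil
  \<comment> \<open>For \<open>u = 0\<close> the quotient is \<open>0 / 0 = 0\<close>; otherwise it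
    equals \<open>admitted_profit G b\<close>.\<close>
  then show ?case using admitted_profit_nonneg[of G b] by auto
next
  case (Cons p ps)
  let ?u = "if known p then u else Suc u"
  let ?f = "\<lambda>b'. SA_arrivals B G adm ?u ps (b', update_phase B G b' Fill)"
  let ?h = "\<lambda>x::sa_buffer \<times> phase. GK_profit G (fst x) + admitted_profit G (fst x)"
  let ?g = "\<lambda>b'. GK_profit G b' + total_profit (K_packets G ps) + (if adm then
      (real ?u * admitted_profit G b' + total_profit (U_packets G ps)) / real (?u + num_U ps) else 0)"
  let ?c = "GK_profit G b + total_profit (K_packets G (p # ps)) + (if adm then
      (real u * admitted_profit G b + total_profit (U_packets G (p # ps)))
        / real (u + num_U (p # ps)) else 0)"
  let ?A = "SA_arrival B G adm (Suc u) p b"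
  have w: "0 < work p" "work p \<le> W" using Cons.prems by auto
  have not_full: "\<not> (known p \<and> in_class G p \<and> num_GK G b = B - 1)"
    using Cons.prems(1,4) by auto
  note fill = SA_arrival_filling[OF Cons.prems(1,2) w not_full]
  have step: "?g b' \<le> measure_pmf.expectation (?f b') ?h" if "b' \<in> set_pmf ?A" for b'
  proof -
    have "num_GK G b' + length (K_packets G ps) < B"
      using fill(2)[OF that] Cons.prems(4) by (auto split: if_splits)
    from Cons.IH[OF Cons.prems(1) fill(1)[OF that] _ this] show ?thesis
      using Cons.prems(3) update_phase_filling[OF fill(1)[OF that]] by simp
  qed
  have "?c \<le> measure_pmf.expectation ?A ?g"
  proof (cases "\<not> known p \<and> adm \<and> 0 < u")
    case False
    show ?thesis
    \<comment> \<open>No coin is tossed for this packet, so it suffices to compare values outcome by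
      outcome.\<close>
    proof (rule expectation_ge_const[OF finite_SA_arrival])
      fix b' assume b': "b' \<in> set_pmf ?A"
      show "?c \<le> ?g b'"
      proof (cases "known p \<or> \<not> adm")
        case True
        then show ?thesis
          using fill(3)[OF b'] SA_arrival_admitted_profit[OF Cons.prems(1,2) w not_full b' True]
          by auto
      next
        case U: False
        with False have u: "u = 0" by auto
        have len: "length b \<le> B" using Cons.prems(2) by (auto simp: filling_def)
        have "kept G (make_room B G b) = kept G b"
          using make_room_kept(1)[OF len filling_GK_add_admitted[OF Cons.prems(1,2)]] u by auto
        then have "admitted_profit G (make_room B G b) = admitted_profit G b"
          by (rule kept_cong)
        also have "\<dots> = 0"
          using Cons.prems(2) u by (intro admitted_profit_eq_0) (auto simp: filling_def)
        finally have "admitted_profit G b' = total_profit (U_packets G [p])"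
          using b' U u by (auto simp: SA_arrival_def)
        then show ?thesis using fill(3)[OF b'] U u by auto
      qed
    qed
  next
    case True
    let ?T = "drop_admitted b @ [fresh p True]" and ?F = "accept_if_room B p b"
    have A: "?A = map_pmf (\<lambda>replace. if replace then ?T else ?F) (bernoulli_pmf (1 / real (Suc u)))"
      using True by (simp add: SA_arrival_def)
    \<comment> \<open>Since \<open>u > 0\<close>, both outcomes have positive probability, and
      \<open>fill\<close> applies to each.\<close>
    have r: "0 < 1 / real (Suc u)" "1 / real (Suc u) < 1" using True by auto
    have T: "?T \<in> set_pmf ?A" and F: "?F \<in> set_pmf ?A"
      using r unfolding A set_map_pmf set_pmf_bernoulli[OF r] by auto
    have adm_T: "admitted_profit G ?T = total_profit (U_packets G [p])"
      using True by (auto simp: drop_admitted_def intro!: admitted_profit_eq_0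
          simp: num_admitted_eq_0)
    have adm_F: "admitted_profit G ?F = admitted_profit G b"
      by (simp add: accept_if_room_def)
    have "measure_pmf.expectation ?A ?g = ?g ?T * (1 / real (Suc u)) + ?g ?F * (1 - 1 / real (Suc u))"
      using r by (subst A) (simp add: integral_map_pmf)
    moreover have "GK_profit G ?T = GK_profit G b" "GK_profit G ?F = GK_profit G b"
      using fill(3)[OF T] fill(3)[OF F] True by auto
    moreover have "(X + (m * v + Y) / N) * (1 / m) + (X + (m * a + Y) / N) * (1 - 1 / m)
        = X + ((m - 1) * a + (v + Y)) / N" if "m > 0" "N > 0" for X Y N m a v :: real
      using that by (simp add: field_simps)
    from this[of "real (Suc u)" "real (Suc u + num_U ps)"
        "GK_profit G b + total_profit (K_packets G ps)" "total_profit (U_packets G [p])"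
        "total_profit (U_packets G ps)" "admitted_profit G b"]
    have "(GK_profit G b + total_profit (K_packets G ps) + (real (Suc u)
        * total_profit (U_packets G [p]) + total_profit (U_packets G ps)) / real (Suc u + num_U ps))
        * (1 / real (Suc u)) + (GK_profit G b + total_profit (K_packets G ps) + (real (Suc u)
        * admitted_profit G b + total_profit (U_packets G ps)) / real (Suc u + num_U ps))
        * (1 - 1 / real (Suc u)) = GK_profit G b + total_profit (K_packets G ps) + (real u
        * admitted_profit G b + (total_profit (U_packets G [p]) + total_profit (U_packets G ps)))
          / real (Suc u + num_U ps)"
      by simp
    moreover have "?c = GK_profit G b + total_profit (K_packets G ps) + (real u
        * admitted_profit G b + (total_profit (U_packets G [p]) + total_profit (U_packets G ps)))
          / real (Suc u + num_U ps)"
      using True by auto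
    ultimately show ?thesis using True adm_T adm_F by simp
  qed
  also have "\<dots> \<le> measure_pmf.expectation (bind_pmf ?A ?f) ?h"
    by (rule expectation_bind_ge[OF finite_SA_arrival finite_SA_arrivals step])
  finally show ?case by simp
qed

subsection \<open>Processing\<close>

definition clear :: "buffered \<Rightarrow> buffered" where
  "clear = admitted_update (\<lambda>_. False)"

definition work_on :: "buffered \<Rightarrow> buffered" where
  "work_on = remaining_update (\<lambda>k. k - 1)"

lemma clear_simps [simp]:
  "pkt (clear x) = pkt x" "remaining (clear x) = remaining x" "\<not> admitted (clear x)"
  "is_GK G (clear x) = is_GK G x"
  by (auto simp: clear_def is_GK_def)

lemma work_on_simps [simp]:
  "pkt (work_on x) = pkt x" "remaining (work_on x) = remaining x - 1"
  by (auto simp: work_on_def)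

lemma is_GK_work_on: "is_GK G x \<Longrightarrow> is_GK G (work_on x)"
  by (auto simp: is_GK_def)

lemma map_clear [simp]:
  "num_GK G (map clear b) = num_GK G b" "GK_profit G (map clear b) = GK_profit G b"
  "residual (map clear b) = residual b"
  by (induction b) auto

lemma SA_process_split:
  assumes "b \<noteq> []"
  obtains l x r where "b = l @ x # r" "SA_process G b = map clear (l @ work_on x # r)"
    "\<And>y. y \<in> set b \<Longrightarrow> rank G x \<le> rank G y"
proof
  let ?i = "highest_index G b"
  show "b = take ?i b @ b ! ?i # drop (Suc ?i) b"
    using highest_index_props[OF assms] by (simp add: id_take_nth_drop)
  show "SA_process G b = map clear (take ?i b @ work_on (b ! ?i) # drop (Suc ?i) b)"
    using assms highest_index_props[OF assms, of G]
    by (simp add: SA_process_def Let_def clear_def work_on_def upd_conv_take_nth_drop)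
  show "rank G (b ! ?i) \<le> rank G y" if "y \<in> set b" for y
    using highest_index_props[OF assms] that by (metis in_set_conv_nth)
qed

lemma SA_process_props:
  assumes "b \<noteq> []" and ok: "\<forall>x\<in>set b. packet_ok W G x" and adm: "num_admitted b \<le> 1"
  shows "length (SA_process G b) = length b" "num_GK G b \<le> num_GK G (SA_process G b)"
    "GK_profit G b + admitted_profit G b \<le> GK_profit G (SA_process G b)"
    "Suc (residual (SA_process G b)) = residual b"
    "\<forall>x\<in>set (SA_process G b). remaining x \<le> work (pkt x) \<and> work (pkt x) \<le> W \<and> \<not> admitted x"
proof -
  obtain l x r where s: "b = l @ x # r" "SA_process G b = map clear (l @ work_on x # r)"
    and rank: "\<And>y. y \<in> set b \<Longrightarrow> rank G x \<le> rank G y"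
    using SA_process_split[OF assms(1)] by metis
  have x: "packet_ok W G x" using ok s(1) by auto
  show "length (SA_process G b) = length b" using s by simp
  show "num_GK G b \<le> num_GK G (SA_process G b)"
    using s is_GK_work_on[of G x] by simp
  show "Suc (residual (SA_process G b)) = residual b"
    using s x by (simp add: packet_ok_def)
  show "\<forall>x\<in>set (SA_process G b). remaining x \<le> work (pkt x) \<and> work (pkt x) \<le> W \<and> \<not> admitted x"
    using s ok by (auto simp: packet_ok_def)
  show "GK_profit G b + admitted_profit G b \<le> GK_profit G (SA_process G b)"
  proof (cases "num_admitted b = 0")
    case True
    then show ?thesis using s is_GK_work_on[of G x] admitted_profit_eq_0[of b G] by auto
  next
    case False
    then obtain y where "y \<in> set b" "admitted y" by (auto simp: num_admitted_eq_0)
    then have "admitted x" using rank[of y] by (auto simp: rank_def split: if_splits)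
    then have "num_admitted l = 0" "num_admitted r = 0" using s(1) adm by auto
    then have "admitted_profit G b = (if in_class G (pkt x) then real (profit (pkt x)) else 0)"
      using s(1) \<open>admitted x\<close> by (simp add: admitted_profit_eq_0)
    moreover have "\<not> is_GK G x" using x \<open>admitted x\<close> by (auto simp: packet_ok_def)
    moreover have "in_class G (pkt x) \<Longrightarrow> is_GK G (work_on x)"
      using x by (auto simp: packet_ok_def is_GK_def)
    ultimately show ?thesis using s by auto
  qed
qed

lemma SA_process_Nil [simp]: "SA_process G [] = []"
  by (simp add: SA_process_def)

subsection \<open>Cycles\<close>

text \<open>Invariant at cycle boundaries, before transmission: remaining work may be 0, and a flush
  whose last packet is finished still has phase flush and a non-empty buffer.\<close>

definition settled :: "nat \<Rightarrow> nat \<Rightarrow> combined_class \<Rightarrow> sa_state \<Rightarrow> bool" where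
  "settled B W G s \<longleftrightarrow> length (buffer s) \<le> B
     \<and> (\<forall>x\<in>set (buffer s). remaining x \<le> work (pkt x) \<and> work (pkt x) \<le> W \<and> \<not> admitted x)
     \<and> (phase s = Flush \<longrightarrow> buffer s \<noteq> [] \<and> (\<forall>x\<in>set (buffer s). is_GK G x))
     \<and> (phase s = Fill \<longrightarrow> num_GK G (buffer s) < B)"

definition unfinished :: "sa_state \<Rightarrow> sa_buffer" where
  "unfinished s = filter (\<lambda>x. remaining x > 0) (buffer s)"

definition gained_after :: "sa_state \<Rightarrow> nat" where
  "gained_after s =
     gained s + sum_list (map (profit \<circ> pkt) (filter (\<lambda>x. remaining x = 0) (buffer s)))"

definition finish_cycle :: "nat \<Rightarrow> combined_class \<Rightarrow> nat \<Rightarrow> sa_buffer \<times> phase \<Rightarrow> sa_state" where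
  "finish_cycle B G g x = \<lparr>buffer = SA_process G (fst x),
     phase = update_phase B G (SA_process G (fst x)) (snd x), gained = g\<rparr>"

text \<open>Isolates the randomness of a cycle: the admittance toss and the arrivals. Transmission
  and processing are functions of the state.\<close>

lemma SA_cycle_eq:
  "SA_cycle B r G ps s = bind_pmf (bernoulli_pmf r) (\<lambda>adm. bind_pmf
     (SA_arrivals B G adm 0 ps (unfinished s, update_phase B G (unfinished s) (phase s)))
     (\<lambda>x. return_pmf (finish_cycle B G (gained_after s) x)))"
  by (simp add: SA_cycle_def unfinished_def gained_after_def finish_cycle_def Let_def
      split_def)

lemma finite_SA_cycle: "finite (set_pmf (SA_cycle B r G ps s))"
  by (simp add: SA_cycle_eq finite_SA_arrivals)

lemma finite_SA_run: "finite (set_pmf (SA_run B r G \<sigma> n))"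
  by (induction n) (auto simp: finite_SA_cycle)

lemma num_GK_filter_le: "num_GK G (filter P b) \<le> num_GK G b"
  by (induction b) auto

text \<open>Transmission moves \<open>G^K\<close>-profit from the buffer into the gain. The fifth
  claim is an inequality because other packets may be transmitted as well.\<close>

lemma unfinished_props:
  assumes "settled B W G s"
  shows "residual (unfinished s) = residual (buffer s)"
    "\<forall>x\<in>set (unfinished s). packet_ok W G x \<and> \<not> admitted x"
    "num_admitted (unfinished s) = 0" "length (unfinished s) \<le> B"
    "real (gained s) + GK_profit G (buffer s) \<le> real (gained_after s) + GK_profit G (unfinished s)"
    "gained s \<le> gained_after s"
proof -
  show "\<forall>x\<in>set (unfinished s). packet_ok W G x \<and> \<not> admitted x"
    using assms by (auto simp: unfinished_def settled_def packet_ok_def)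
  then show "num_admitted (unfinished s) = 0" by (auto simp: num_admitted_eq_0)
  show "length (unfinished s) \<le> B"
    using assms by (auto simp: unfinished_def settled_def intro: order_trans[OF length_filter_le])
  have "residual (filter (\<lambda>x. remaining x > 0) b) = residual b" for b
    by (induction b) auto
  then show "residual (unfinished s) = residual (buffer s)"
    by (simp add: unfinished_def)
  have "GK_profit G b \<le> real (sum_list (map (profit \<circ> pkt) (filter (\<lambda>x. remaining x = 0) b)))
      + GK_profit G (filter (\<lambda>x. remaining x > 0) b)" for b
    by (induction b) auto
  then show "real (gained s) + GK_profit G (buffer s)
      \<le> real (gained_after s) + GK_profit G (unfinished s)"
    by (simp add: gained_after_def unfinished_def)
  show "gained s \<le> gained_after s" by (simp add: gained_after_def)
qed

text \<open>This includes the end of a flush: transmission has emptied the buffer, and the phase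
  update before the arrivals returns to fill.\<close>

lemma start_filling:
  assumes "2 \<le> B" "settled B W G s" "phase s = Fill \<or> unfinished s = []"
  shows "filling B W G adm 0 (unfinished s)"
    "update_phase B G (unfinished s) (phase s) = Fill"
proof -
  have "num_GK G (unfinished s) < B"
    using assms num_GK_filter_le[of G "\<lambda>x. remaining x > 0" "buffer s"]
    by (auto simp: settled_def unfinished_def intro: le_less_trans)
  then show "filling B W G adm 0 (unfinished s)"
    "update_phase B G (unfinished s) (phase s) = Fill"
    using unfinished_props[OF assms(2)] assms(3)
    by (auto simp: filling_def update_phase_def)
qed

lemma settled_finish_cycle:
  assumes "2 \<le> B" and ok: "\<forall>x\<in>set b. packet_ok W G x" and "num_admitted b \<le> 1" "length b \<le> B"
    and "ph = Flush \<Longrightarrow> b \<noteq> [] \<and> num_GK G b = length b"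
  shows "settled B W G (finish_cycle B G g (b, ph))"
    "phase (finish_cycle B G g (b, ph)) = Flush \<longleftrightarrow>
       ph = Flush \<or> num_GK G (SA_process G b) = B"
proof -
  have "settled B W G (finish_cycle B G g (b, ph)) \<and>
    (phase (finish_cycle B G g (b, ph)) = Flush \<longleftrightarrow>
       ph = Flush \<or> num_GK G (SA_process G b) = B)"
  proof (cases "b = []")
    case True
    then show ?thesis
      using assms by (cases ph) (auto simp: settled_def finish_cycle_def update_phase_def)
  next
    case False
    note p = SA_process_props[OF False ok assms(3)]
    have ne: "SA_process G b \<noteq> []" using p(1) False by auto
    have le: "num_GK G (SA_process G b) \<le> length b"
      using num_GK_le_length[of G "SA_process G b"] p(1) by simp
    have "ph = Flush \<or> num_GK G (SA_process G b) = B \<Longrightarrow> \<forall>x\<in>set (SA_process G b). is_GK G x"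
      using all_GK_if_num_GK[of G "SA_process G b"] assms(4,5) p(1,2) le by fastforce
    then show ?thesis
      using ne p(1,5) le assms(4)
      by (cases ph) (auto simp: settled_def finish_cycle_def update_phase_def)
  qed
  then show "settled B W G (finish_cycle B G g (b, ph))"
    "phase (finish_cycle B G g (b, ph)) = Flush \<longleftrightarrow>
       ph = Flush \<or> num_GK G (SA_process G b) = B" by auto
qed

subsection \<open>The potential of a run for one selected class\<close>

definition GK_value :: "combined_class \<Rightarrow> sa_state \<Rightarrow> real" where
  "GK_value G s = real (gained s) + GK_profit G (buffer s)"

text \<open>Ignoring buffered profit in phase fill makes this jump by the whole
  \<open>GK_profit\<close> when a flush starts. The jump pays for the switch inside
  \<open>offline_bound\<close>.\<close>

definition flush_value :: "combined_class \<Rightarrow> sa_state \<Rightarrow> real" where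
  "flush_value G s = real (gained s) + (if phase s = Flush then GK_profit G (buffer s) else 0)"

text \<open>The classes enter through lower and upper bounds, later instantiated with the minima and
  maxima of the two blocks.\<close>

locale selected_class =
  fixes B W M :: nat and r :: real and G :: combined_class and wlo whi vlo vhi :: nat
  assumes B: "2 \<le> B" and M: "1 \<le> M" and r: "0 < r" "r \<le> 1"
    and wlo: "0 < wlo" "wlo \<le> whi" and vlo: "0 < vlo" "vlo \<le> vhi"
    and work_class: "\<And>w. w \<in> fst G \<Longrightarrow> wlo \<le> w \<and> w \<le> whi"
    and profit_class: "\<And>v. v \<in> snd G \<Longrightarrow> vlo \<le> v \<and> v \<le> vhi"
begin

text \<open>The most profit from completed packets of \<open>G\<close> that a unit of offline work
  can yield.\<close>

definition rate :: real where
  "rate = real vhi / real wlo"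

text \<open>The 4 counts the four terms estimated in \<open>flush_pays\<close> and reappears as the
  constant of the final bound.\<close>

definition flush_factor :: real where
  "flush_factor = 4 * (real whi / real wlo) * (real vhi / real vlo)"

text \<open>\<open>\<Psi>\<close> is to be read as the offline profit from \<open>G\<close> with all buffered packets
  counted as transmitted, and \<open>D\<close> as the same with buffered packets counted in proportion to
  the work done on them. During a flush, the offline profit is paid for by the residual work.\<close>

definition offline_bound :: "real \<Rightarrow> real \<Rightarrow> sa_state \<Rightarrow> real" where
  "offline_bound \<Psi> D s = (if phase s = Fill then \<Psi>
     else D + real B * real vhi + rate * real (residual (buffer s)))"

text \<open>The potential. For the first summand a bound in expectation is used, while the bracket
  is estimated separately for every outcome of a cycle.\<close>

definition surplus :: "real \<Rightarrow> real \<Rightarrow> sa_state \<Rightarrow> real" where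
  "surplus \<Psi> D s = real M / r * GK_value G s + (flush_factor * flush_value G s - offline_bound \<Psi> D s)"

section \<open>Numerical bounds for a flush\<close>

lemma rate_nonneg: "0 \<le> rate" and flush_factor_nonneg: "0 \<le> flush_factor"
  by (simp_all add: rate_def flush_factor_def)

lemma vhi_le_rate: "real vhi \<le> rate * real whi"
proof -
  have "real vhi * real wlo \<le> real vhi * real whi" using wlo by (intro mult_left_mono) auto
  then show ?thesis using wlo by (simp add: rate_def field_simps)
qed

lemma rate_le: "rate \<le> rate * real whi"
proof -
  have "1 \<le> real whi" using wlo by simp
  then show ?thesis using mult_left_mono[of 1 "real whi" rate] rate_nonneg by simp
qed

lemma flush_factor_vlo: "flush_factor * real vlo = 4 * (rate * real whi)"
  using vlo wlo by (simp add: flush_factor_def rate_def)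

lemma residual_le:
  assumes "\<forall>x\<in>set b. is_GK G x \<and> remaining x \<le> work (pkt x)"
  shows "residual b \<le> length b * whi"
  using assms
proof (induction b)
  case (Cons x b)
  then have "remaining x \<le> whi"
    using work_class[of "work (pkt x)"] by (auto simp: is_GK_def in_class_def)
  then show ?case using Cons by auto
qed simp

lemma GK_profit_ge: "real (num_GK G b) * real vlo \<le> GK_profit G b"
proof (induction b)
  case (Cons x b)
  have "is_GK G x \<Longrightarrow> real vlo \<le> real (profit (pkt x))"
    using profit_class[of "profit (pkt x)"] by (auto simp: is_GK_def in_class_def)
  then show ?case using Cons by (auto simp: algebra_simps)
qed simp

text \<open>At the start of a flush the buffer holds \<open>B\<close> packets of \<open>G\<close>,
  worth at least \<open>B * vlo\<close>. Beyond \<open>\<Psi>\<close> there are four terms to pay,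
  \<open>B * vhi\<close>, \<open>rate * residual b\<close>, \<open>B * rate * whi\<close> and
  \<open>rate\<close>, each at most \<open>B * rate * whi\<close>.\<close>

lemma flush_pays:
  assumes "length b \<le> B" "num_GK G b = B" "\<forall>x\<in>set b. remaining x \<le> work (pkt x)"
    "D \<le> \<Psi> + (real B * (rate * real whi) + rate)"
  shows "D + real B * real vhi + rate * real (residual b) \<le> \<Psi> + flush_factor * GK_profit G b"
proof -
  have l: "length b = B" using assms(1,2) num_GK_le_length[of G b] by simp
  have "residual b \<le> B * whi"
    using residual_le[of b] all_GK_if_num_GK[of G b] assms l by auto
  then have "rate * real (residual b) \<le> rate * real (B * whi)"
    by (intro mult_left_mono rate_nonneg of_nat_mono)
  moreover have "real B * real vhi \<le> real B * (rate * real whi)"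
    using vhi_le_rate by (intro mult_left_mono) auto
  moreover have "flush_factor * (real B * real vlo) \<le> flush_factor * GK_profit G b"
    using GK_profit_ge[of b] assms(2) by (intro mult_left_mono flush_factor_nonneg) simp
  moreover have "flush_factor * (real B * real vlo) = 4 * (real B * (rate * real whi))"
    using flush_factor_vlo by (simp add: algebra_simps)
  moreover have "rate \<le> real B * (rate * real whi)"
    using rate_le mult_mono[of 1 "real B" rate "rate * real whi"] B rate_nonneg by simp
  moreover have "rate * real (B * whi) = real B * (rate * real whi)" by simp
  ultimately show ?thesis using assms(4) by linarith
qed

text \<open>K-packets of \<open>G\<close> are secured with certainty. A U-packet of \<open>G\<close>
  is secured with probability at least \<open>r / M\<close>: the cycle is an admittance cycle with
  probability \<open>r\<close>, and sampling is uniform among at most \<open>M\<close>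
  packets.\<close>

lemma GK_value_good_cycle:
  assumes s: "settled B W G s" "phase s = Fill \<or> unfinished s = []"
    and ps: "\<forall>p\<in>set ps. 0 < work p \<and> work p \<le> W" "num_U ps \<le> M"
    and good: "num_GK G (unfinished s) + length (K_packets G ps) < B"
  shows "GK_value G s + r / real M * total_profit (filter (in_class G) ps)
    \<le> measure_pmf.expectation (SA_cycle B r G ps s) (GK_value G)"
proof -
  let ?b = "unfinished s" and ?K = "total_profit (K_packets G ps)"
    and ?U = "total_profit (U_packets G ps)"
  let ?A = "\<lambda>adm. SA_arrivals B G adm 0 ps (?b, Fill)"
  let ?f = "\<lambda>x. return_pmf (finish_cycle B G (gained_after s) x)"
  note fill = start_filling[OF B s]
  \<comment> \<open>Replaces the number of U-packets by its bound \<open>M\<close>; without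
    U-packets both sides are 0.\<close>
  have kept_U: "r / real M * ?U \<le> r * (?U / real (num_U ps))"
  proof (cases "num_U ps = 0")
    case True
    then have "U_packets G ps = []" by (auto simp: num_U_def U_packets_def filter_empty_conv)
    then show ?thesis by simp
  next
    case False
    then have "?U / real M \<le> ?U / real (num_U ps)"
      using ps(2) by (intro divide_left_mono total_profit_nonneg) auto
    then show ?thesis using mult_left_mono[of _ _ r] r by fastforce
  qed
  have cyc: "real (gained_after s) + (GK_profit G ?b + ?K + (if adm then ?U / real (num_U ps) else 0))
      \<le> measure_pmf.expectation (bind_pmf (?A adm) ?f) (GK_value G)" for adm
  proof -
    let ?h = "\<lambda>x. GK_profit G (fst x) + admitted_profit G (fst x)"
    have "real (gained_after s) + (GK_profit G ?b + ?K + (if adm then ?U / real (num_U ps) else 0))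
        \<le> real (gained_after s) + measure_pmf.expectation (?A adm) ?h"
      using reservoir_sampling[OF B fill(1) ps(1) good, of adm] by (cases adm) simp_all
    also have "\<dots> = measure_pmf.expectation (?A adm) (\<lambda>x. real (gained_after s) + ?h x)"
      by (subst Bochner_Integration.integral_add)
        (auto intro: integrable_measure_pmf_finite finite_SA_arrivals)
    also have "\<dots> \<le> measure_pmf.expectation (bind_pmf (?A adm) ?f) (GK_value G)"
    proof (rule expectation_bind_ge[OF finite_SA_arrivals])
      fix x assume "x \<in> set_pmf (?A adm)"
      moreover obtain b' ph' where x: "x = (b', ph')" by (cases x)
      ultimately obtain u' where "filling B W G adm u' b'"
        using SA_arrivals_outcome[OF B fill(1) ps(1), of b' ph'] good by auto
      then have ok: "\<forall>x\<in>set b'. packet_ok W G x" "num_admitted b' \<le> 1"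
        by (auto simp: filling_def)
      show "real (gained_after s) + ?h x \<le> measure_pmf.expectation (?f x) (GK_value G)"
        using SA_process_props(3)[OF _ ok]
        by (cases "b' = []") (simp_all add: x finish_cycle_def GK_value_def)
    qed simp
    finally show ?thesis .
  qed
  \<comment> \<open>Weakening certainty to \<open>r / M\<close> for the K-packets gives both kinds
    of packets a common factor.\<close>
  have "r / real M \<le> 1" using r M by (simp add: field_simps)
  then have kept_K: "r / real M * ?K \<le> ?K"
    using total_profit_nonneg by (intro mult_left_le_one_le) (use r in auto)
  have split: "total_profit (filter (in_class G) ps) = ?K + ?U"
    by (induction ps) auto
  have "GK_value G s + r / real M * total_profit (filter (in_class G) ps)
      \<le> real (gained_after s) + GK_profit G ?b + ?K + r * (?U / real (num_U ps))"
    using unfinished_props(5)[OF s(1)] kept_K kept_U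
    unfolding GK_value_def split distrib_left by linarith
  also have "\<dots> = measure_pmf.expectation (bernoulli_pmf r) (\<lambda>adm. real (gained_after s)
      + (GK_profit G ?b + ?K + (if adm then ?U / real (num_U ps) else 0)))"
    using r by (simp add: algebra_simps)
  also have "\<dots> \<le> measure_pmf.expectation (SA_cycle B r G ps s) (GK_value G)"
    unfolding SA_cycle_eq fill(2)
    by (rule expectation_bind_ge[OF _ _ cyc]) (simp_all add: finite_SA_arrivals)
  finally show ?thesis .
qed

text \<open>A cycle either continues a flush and discards its arrivals, or handles them in phase
  fill. In the latter case, too many K-packets of \<open>G\<close> force a flush whatever the coin
  tosses.\<close>

lemma SA_cycle_cases:
  assumes s: "settled B W G s" and ps: "\<forall>p\<in>set ps. 0 < work p \<and> work p \<le> W"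
    and s': "s' \<in> set_pmf (SA_cycle B r G ps s)"
  shows "settled B W G s'" "GK_value G s \<le> GK_value G s'" "gained s' = gained_after s"
    and "phase s = Flush \<Longrightarrow> unfinished s \<noteq> [] \<Longrightarrow>
      phase s' = Flush \<and> Suc (residual (buffer s')) = residual (buffer s)"
    and "phase s = Fill \<or> unfinished s = [] \<Longrightarrow>
      (phase s' = Flush \<longrightarrow> num_GK G (buffer s') = B) \<and>
      (\<not> num_GK G (unfinished s) + length (K_packets G ps) < B \<longrightarrow> phase s' = Flush)"
proof -
  let ?b = "unfinished s"
  note u = unfinished_props[OF s]
  from s' obtain adm b' ph' where x:
    "(b', ph') \<in> set_pmf (SA_arrivals B G adm 0 ps (?b, update_phase B G ?b (phase s)))"
    "s' = finish_cycle B G (gained_after s) (b', ph')"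
    by (auto simp: SA_cycle_eq)
  have "settled B W G s' \<and> GK_value G s \<le> GK_value G s' \<and>
    (phase s = Flush \<longrightarrow> ?b \<noteq> [] \<longrightarrow>
      phase s' = Flush \<and> Suc (residual (buffer s')) = residual (buffer s)) \<and>
    (phase s = Fill \<or> unfinished s = [] \<longrightarrow> (phase s' = Flush \<longrightarrow> num_GK G (buffer s') = B) \<and>
      (\<not> num_GK G ?b + length (K_packets G ps) < B \<longrightarrow> phase s' = Flush))"
  proof (cases "phase s = Flush \<and> ?b \<noteq> []")
    case True
    then have "b' = ?b" "ph' = Flush" using x(1) by (auto simp: update_phase_def split: if_splits)
    have ok: "\<forall>x\<in>set b'. packet_ok W G x" "num_admitted b' \<le> 1" "length b' \<le> B"
      using u \<open>b' = ?b\<close> by auto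
    have "\<forall>x\<in>set ?b. is_GK G x"
      using s True by (auto simp: settled_def unfinished_def)
    then have all: "num_GK G b' = length b'" by (simp add: num_GK_def \<open>b' = ?b\<close>)
    have ne: "b' \<noteq> []" using True \<open>b' = ?b\<close> by simp
    note p = SA_process_props[OF ne ok(1,2)]
    have "GK_value G s \<le> GK_value G s'"
      using p(3) u(5) admitted_profit_nonneg[of G b'] x(2) \<open>b' = ?b\<close>
      by (simp add: GK_value_def finish_cycle_def)
    moreover have "Suc (residual (buffer s')) = residual (buffer s)"
      using p(4) u(1) x(2) \<open>b' = ?b\<close> by (simp add: finish_cycle_def)
    ultimately show ?thesis
      using settled_finish_cycle[OF B ok, of ph'] all ne True x(2) \<open>ph' = Flush\<close> by auto
  next
    case False
    then have fill: "phase s = Fill \<or> ?b = []" by (metis phase.exhaust)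
    note st = start_filling[OF B s fill]
    note out = SA_arrivals_outcome[OF B st(1) ps x(1)[unfolded st(2)]]
    have ok: "\<forall>x\<in>set b'. packet_ok W G x" "num_admitted b' \<le> 1" "length b' \<le> B"
    proof -
      have "(\<exists>u'. filling B W G adm u' b') \<or> gfull B W G b'" using out by (auto split: if_splits)
      moreover have "num_admitted b' = 0" if "gfull B W G b'"
        using that all_GK_if_num_GK[of G b'] by (auto simp: num_admitted_eq_0 gfull_def packet_ok_def)
      ultimately show "\<forall>x\<in>set b'. packet_ok W G x" "num_admitted b' \<le> 1" "length b' \<le> B"
        by (auto simp: filling_def gfull_def)
    qed
    have flush: "ph' = Flush \<Longrightarrow> b' \<noteq> [] \<and> num_GK G b' = length b' \<and> num_GK G b' = B"
      using out B by (auto simp: gfull_def split: if_splits)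
    have GK_le: "GK_profit G b' \<le> GK_profit G (SA_process G b')"
      "num_GK G b' \<le> num_GK G (SA_process G b')" "length (SA_process G b') = length b'"
      using SA_process_props(1-3)[OF _ ok(1,2)] admitted_profit_nonneg[of G b']
      by (cases "b' = []"; force)+
    have "GK_value G s \<le> GK_value G s'"
      using GK_le(1) out u(5) x(2) by (simp add: GK_value_def finish_cycle_def)
    moreover have "num_GK G (SA_process G b') \<le> B"
      using num_GK_le_length[of G "SA_process G b'"] GK_le(3) ok(3) by simp
    ultimately show ?thesis
      using settled_finish_cycle[OF B ok, of ph'] flush GK_le(2) x(2) out False
      by (auto simp: finish_cycle_def split: if_splits)
  qed
  then show "settled B W G s'" "GK_value G s \<le> GK_value G s'"
    "phase s = Flush \<Longrightarrow> unfinished s \<noteq> [] \<Longrightarrow>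
      phase s' = Flush \<and> Suc (residual (buffer s')) = residual (buffer s)"
    "phase s = Fill \<or> unfinished s = [] \<Longrightarrow>
      (phase s' = Flush \<longrightarrow> num_GK G (buffer s') = B) \<and>
      (\<not> num_GK G (unfinished s) + length (K_packets G ps) < B \<longrightarrow> phase s' = Flush)"
    by blast+
  show "gained s' = gained_after s" using x(2) by (simp add: finish_cycle_def)
qed

text \<open>During a flush, \<open>D\<close> grows by at most \<open>rate\<close> while
  \<open>rate * residual\<close> falls by \<open>rate\<close>. If the K-packets do not fill the
  buffer, the growth of \<open>\<Psi>\<close> is matched by \<open>M / r\<close> times the expected
  growth of \<open>GK_value\<close>. Otherwise a flush is certain to start and
  \<open>flush_pays\<close> applies.\<close>

lemma surplus_SA_cycle:
  assumes s: "settled B W G s"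
    and ps: "\<forall>p\<in>set ps. 0 < work p \<and> work p \<le> W" "num_U ps \<le> M"
    and psi: "\<Psi>' \<le> \<Psi> + total_profit (filter (in_class G) ps)" "\<Psi> \<le> D + real B * real vhi"
    and D: "D' \<le> D + rate" "D \<le> \<Psi> + real B * (rate * real whi)"
      "D' \<le> \<Psi>' + real B * (rate * real whi)"
  shows "surplus \<Psi> D s \<le> measure_pmf.expectation (SA_cycle B r G ps s) (surplus \<Psi>' D')"
proof -
  let ?g = "real (gained_after s)" and ?a = "total_profit (filter (in_class G) ps)"
  let ?S = "SA_cycle B r G ps s"
  let ?Y = "\<lambda>s. flush_factor * flush_value G s - offline_bound \<Psi>' D' s"
  have Mr: "0 \<le> real M / r" using r by simp
  note c = SA_cycle_cases[OF s ps(1)]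
  have combine: "surplus \<Psi> D s \<le> measure_pmf.expectation ?S (surplus \<Psi>' D')"
    if x: "x \<le> measure_pmf.expectation ?S (GK_value G)"
      and y: "\<And>s'. s' \<in> set_pmf ?S \<Longrightarrow> y \<le> ?Y s'"
      and le: "surplus \<Psi> D s \<le> real M / r * x + y" for x y
  proof -
    have "measure_pmf.expectation ?S (surplus \<Psi>' D') =
        real M / r * measure_pmf.expectation ?S (GK_value G) + measure_pmf.expectation ?S ?Y"
      unfolding surplus_def by (subst Bochner_Integration.integral_add)
        (auto intro: integrable_measure_pmf_finite finite_SA_cycle)
    moreover have "y \<le> measure_pmf.expectation ?S ?Y"
      by (rule expectation_ge_const[OF finite_SA_cycle y])
    moreover have "real M / r * x \<le> real M / r * measure_pmf.expectation ?S (GK_value G)"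
      using x Mr by (rule mult_left_mono)
    ultimately show ?thesis using le by linarith
  qed
  have mono: "GK_value G s \<le> measure_pmf.expectation ?S (GK_value G)"
    by (rule expectation_ge_const[OF finite_SA_cycle c(2)])
  show ?thesis
  proof (cases "phase s = Flush \<and> unfinished s \<noteq> []")
    case True
    show ?thesis
    proof (rule combine[OF mono])
      fix s' assume s': "s' \<in> set_pmf ?S"
      have f: "phase s' = Flush" "Suc (residual (buffer s')) = residual (buffer s)"
        using c(4)[OF s'] True by auto
      have "rate * real (residual (buffer s)) = rate * real (residual (buffer s')) + rate"
        unfolding f(2)[symmetric] by (simp add: algebra_simps)
      moreover have "flush_factor * GK_value G s \<le> flush_factor * GK_value G s'"
        by (rule mult_left_mono[OF c(2)[OF s'] flush_factor_nonneg])
      ultimately show "flush_factor * flush_value G s - offline_bound \<Psi> D s \<le> ?Y s'"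
        using f(1) True D(1) by (simp add: flush_value_def offline_bound_def GK_value_def)
    qed (simp add: surplus_def)
  next
    case False
    then have fill: "phase s = Fill \<or> unfinished s = []" by (metis phase.exhaust)
    \<comment> \<open>If a flush has just ended, transmission has put its \<open>G^K\<close>-profit
      into the gain, and \<open>offline_bound\<close> may be lowered to
      \<open>\<Psi>\<close>.\<close>
    have start: "flush_factor * flush_value G s - offline_bound \<Psi> D s \<le> flush_factor * ?g - \<Psi>"
    proof -
      have "flush_value G s \<le> ?g"
        using unfinished_props(5,6)[OF s] fill by (auto simp: flush_value_def)
      then have "flush_factor * flush_value G s \<le> flush_factor * ?g"
        by (rule mult_left_mono[OF _ flush_factor_nonneg])
      moreover have "0 \<le> rate * real (residual (buffer s))" using rate_nonneg by simp
      then have "\<Psi> \<le> offline_bound \<Psi> D s" using psi(2) unfolding offline_bound_def by auto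
      ultimately show ?thesis by linarith
    qed
    \<comment> \<open>\<open>X\<close> is the part of the offline profit that is not charged to the
      new flush.\<close>
    have flush: "flush_factor * ?g - X \<le> ?Y s'"
      if s': "s' \<in> set_pmf ?S" "phase s' = Flush" and "D' \<le> X + (real B * (rate * real whi) + rate)" for s' X
    proof -
      have "settled B W G s'" "num_GK G (buffer s') = B" "gained s' = gained_after s"
        using c(1,3,5)[OF s'(1)] fill s'(2) by auto
      then show ?thesis
        using flush_pays[of "buffer s'" D' X] that(3) s'(2)
        by (simp add: settled_def flush_value_def offline_bound_def algebra_simps)
    qed
    show ?thesis
    proof (cases "num_GK G (unfinished s) + length (K_packets G ps) < B")
      case True
      show ?thesis
      proof (rule combine[OF GK_value_good_cycle[OF s fill ps True]])
        fix s' assume s': "s' \<in> set_pmf ?S"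
        show "flush_factor * ?g - (\<Psi> + ?a) \<le> ?Y s'"
        proof (cases "phase s'")
          case Fill
          then show ?thesis using c(3)[OF s'] psi(1)
            by (simp add: flush_value_def offline_bound_def)
        next
          case Flush
          \<comment> \<open>The flush is triggered here by parsing in the processing step. The
            arrivals are already paid for by the expected growth, so \<open>\<Psi> + ?a\<close> is
            available.\<close>
          have "D' \<le> (\<Psi> + ?a) + (real B * (rate * real whi) + rate)"
            using D(3) psi(1) rate_nonneg by simp
          then show ?thesis by (rule flush[OF s' Flush])
        qed
      next
        have "real M / r * (GK_value G s + r / real M * ?a) = real M / r * GK_value G s + ?a"
          using r M by (simp add: distrib_left)
        then show "surplus \<Psi> D s \<le> real M / r * (GK_value G s + r / real M * ?a)
            + (flush_factor * ?g - (\<Psi> + ?a))"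
          using start unfolding surplus_def by linarith
      qed
    next
      case bad: False
      show ?thesis
      proof (rule combine[OF mono])
        fix s' assume s': "s' \<in> set_pmf ?S"
        \<comment> \<open>Passing through the old \<open>D\<close> and \<open>\<Psi>\<close> keeps
          this cycle's arrivals, whose total profit is unbounded, out of the estimate.\<close>
        have "D' \<le> \<Psi> + (real B * (rate * real whi) + rate)" using D(1,2) by simp
        then show "flush_factor * ?g - \<Psi> \<le> ?Y s'"
          using flush[OF s'] c(5)[OF s'] fill bad by blast
      qed (use start in \<open>simp add: surplus_def\<close>)
    qed
  qed
qed

end

section \<open>Iterating the one-cycle estimates over a run\<close>

context selected_class
begin

context
  fixes \<sigma> :: arrivals
  assumes arrivals: "\<And>n. \<forall>p\<in>set (arrivals_at \<sigma> n). 0 < work p \<and> work p \<le> W"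
    "\<And>n. num_U (arrivals_at \<sigma> n) \<le> M"
begin

lemma settled_SA_run: "s \<in> set_pmf (SA_run B r G \<sigma> n) \<Longrightarrow> settled B W G s"
proof (induction n arbitrary: s)
  case 0
  then show ?case using B by (simp add: settled_def)
next
  case (Suc n)
  then show ?case using SA_cycle_cases(1)[OF _ arrivals(1)] by auto
qed

text \<open>Allows the offline gain at one time to be compared with the run at a later time, when
  the buffer has drained.\<close>

lemma GK_value_SA_run_mono:
  "m \<le> n \<Longrightarrow> measure_pmf.expectation (SA_run B r G \<sigma> m) (GK_value G)
    \<le> measure_pmf.expectation (SA_run B r G \<sigma> n) (GK_value G)"
proof (rule lift_Suc_mono_le[of "\<lambda>n. measure_pmf.expectation (SA_run B r G \<sigma> n) (GK_value G)"])
  fix n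
  show "measure_pmf.expectation (SA_run B r G \<sigma> n) (GK_value G)
    \<le> measure_pmf.expectation (SA_run B r G \<sigma> (Suc n)) (GK_value G)"
    unfolding SA_run.simps
    by (rule expectation_bind_ge[OF finite_SA_run finite_SA_cycle expectation_ge_const[OF
          finite_SA_cycle SA_cycle_cases(2)[OF settled_SA_run arrivals(1)]]])
qed

text \<open>The offline schedule enters only through \<open>\<Psi>\<close>, \<open>D\<close> and
  \<open>gain\<close>, which keeps the argument independent of the offline model. The expected
  surplus starts at 0 and never decreases.\<close>

lemma offline_le_GK_value:
  fixes \<Psi> D gain :: "nat \<Rightarrow> real"
  assumes "\<Psi> 0 = 0"
    and \<Psi>: "\<And>n. \<Psi> (Suc n) \<le> \<Psi> n + total_profit (filter (in_class G) (arrivals_at \<sigma> n))"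
      "\<And>n. \<Psi> n \<le> D n + real B * real vhi"
    and D: "\<And>n. D (Suc n) \<le> D n + rate" "\<And>n. D n \<le> \<Psi> n + real B * (rate * real whi)"
    and gain: "gain n \<le> \<Psi> n" "gain n \<le> D n"
  shows "gain n \<le> (real M / r + flush_factor)
    * measure_pmf.expectation (SA_run B r G \<sigma> n) (GK_value G)"
proof -
  let ?R = "SA_run B r G \<sigma>"
  have "0 \<le> measure_pmf.expectation (?R n) (surplus (\<Psi> n) (D n))"
  proof (induction n)
    case 0
    then show ?case
      using assms(1) by (simp add: surplus_def GK_value_def flush_value_def offline_bound_def)
  next
    case (Suc n)
    also have "measure_pmf.expectation (?R n) (surplus (\<Psi> n) (D n))
        \<le> measure_pmf.expectation (?R (Suc n)) (surplus (\<Psi> (Suc n)) (D (Suc n)))"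
      unfolding SA_run.simps
      by (rule expectation_bind_ge[OF finite_SA_run finite_SA_cycle
            surplus_SA_cycle[OF settled_SA_run arrivals \<Psi> D D(2)]])
    finally show ?case .
  qed
  also have "\<dots> \<le> measure_pmf.expectation (?R n)
      (\<lambda>s. (real M / r + flush_factor) * GK_value G s - gain n)"
  proof (intro integral_mono_AE integrable_measure_pmf_finite finite_SA_run)
    show "AE s in measure_pmf (?R n).
        surplus (\<Psi> n) (D n) s \<le> (real M / r + flush_factor) * GK_value G s - gain n"
    proof (rule AE_pmfI)
      fix s
      have "flush_value G s \<le> GK_value G s"
        using GK_profit_nonneg[of G "buffer s"] by (simp add: flush_value_def GK_value_def)
      then have "flush_factor * flush_value G s \<le> flush_factor * GK_value G s"
        by (rule mult_left_mono[OF _ flush_factor_nonneg])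
      moreover have "0 \<le> real B * real vhi + rate * real (residual (buffer s))"
        using rate_nonneg by simp
      then have "gain n \<le> offline_bound (\<Psi> n) (D n) s"
        using gain unfolding offline_bound_def by auto
      ultimately show
        "surplus (\<Psi> n) (D n) s \<le> (real M / r + flush_factor) * GK_value G s - gain n"
        unfolding surplus_def distrib_right by linarith
    qed
  qed
  also have "\<dots> = (real M / r + flush_factor) * measure_pmf.expectation (?R n) (GK_value G) - gain n"
    by (subst Bochner_Integration.integral_diff)
      (auto intro: integrable_measure_pmf_finite finite_SA_run)
  finally show ?thesis by simp
qed

section \<open>Draining the buffer after the last arrival\<close>

lemma SA_cycle_no_arrivals:
  assumes "settled B W G s" "s' \<in> set_pmf (SA_cycle B r G [] s)"
  shows "residual (buffer s') \<le> residual (buffer s) - 1"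
    and "residual (buffer s) = 0 \<Longrightarrow> buffer s' = []"
proof -
  let ?b = "unfinished s"
  note u = unfinished_props[OF assms(1)]
  have b: "buffer s' = SA_process G ?b"
    using assms(2) by (auto simp: SA_cycle_eq finish_cycle_def)
  have "Suc (residual (buffer s')) = residual (buffer s)" if "?b \<noteq> []"
    using SA_process_props(4)[OF that, of W G] u b by auto
  then show "residual (buffer s') \<le> residual (buffer s) - 1"
    and "residual (buffer s) = 0 \<Longrightarrow> buffer s' = []"
    using b by (cases "?b = []"; fastforce)+
qed

lemma residual_after_arrivals:
  "s \<in> set_pmf (SA_run B r G \<sigma> (length \<sigma> + k)) \<Longrightarrow> residual (buffer s) \<le> B * W - k"
proof (induction k arbitrary: s)
  case 0
  have "residual b \<le> length b * W" if "\<forall>x\<in>set b. remaining x \<le> W" for b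
    using that by (induction b) auto
  from this[of "buffer s"] have "residual (buffer s) \<le> length (buffer s) * W"
    using settled_SA_run[OF 0] unfolding settled_def by fastforce
  also have "\<dots> \<le> B * W" using settled_SA_run[OF 0] by (simp add: settled_def)
  finally show ?case by simp
next
  case (Suc k)
  then obtain s0 where s0: "s0 \<in> set_pmf (SA_run B r G \<sigma> (length \<sigma> + k))"
    "s \<in> set_pmf (SA_cycle B r G [] s0)"
    by (auto simp: arrivals_at_def)
  show ?case
    using SA_cycle_no_arrivals(1)[OF settled_SA_run[OF s0(1)] s0(2)] Suc.IH[OF s0(1)] by simp
qed

text \<open>After the last arrival at most \<open>B * W\<close> units of work are left. The strict
  inequality provides one more cycle, which transmits the last finished packet.\<close>

lemma drained:
  assumes "length \<sigma> + B * W < n" "s \<in> set_pmf (SA_run B r G \<sigma> n)"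
  shows "buffer s = []"
proof -
  obtain k where k: "n = Suc (length \<sigma> + (B * W + k))"
    using assms(1) less_imp_Suc_add by (metis add.assoc)
  then obtain s0 where s0: "s0 \<in> set_pmf (SA_run B r G \<sigma> (length \<sigma> + (B * W + k)))"
    "s \<in> set_pmf (SA_cycle B r G [] s0)"
    using assms(2) by (auto simp: arrivals_at_def)
  show ?thesis
    using SA_cycle_no_arrivals(2)[OF settled_SA_run[OF s0(1)] s0(2)]
      residual_after_arrivals[OF s0(1)] by simp
qed

text \<open>A drained state is a fixed point of \<open>SA_cycle\<close>; this later makes the
  expected gains bounded, as the supremum in \<open>SA_throughput\<close> requires.\<close>

lemma SA_run_constant:
  assumes "length \<sigma> + B * W < n"
  shows "SA_run B r G \<sigma> (Suc n) = SA_run B r G \<sigma> n"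
proof -
  have "SA_cycle B r G (arrivals_at \<sigma> n) s = return_pmf s" if "s \<in> set_pmf (SA_run B r G \<sigma> n)" for s
  proof -
    have b: "buffer s = []" by (rule drained[OF assms that])
    then have "phase s = Fill"
      using settled_SA_run[OF that] by (cases "phase s") (auto simp: settled_def)
    then show ?thesis
      using b assms by (cases s) (simp add: arrivals_at_def SA_cycle_eq unfinished_def
          gained_after_def update_phase_def finish_cycle_def bind_return_pmf)
  qed
  then have "SA_run B r G \<sigma> (Suc n) = bind_pmf (SA_run B r G \<sigma> n) return_pmf"
    by (auto intro: bind_pmf_cong)
  then show ?thesis by (simp add: bind_return_pmf')
qed

lemma GK_value_drained:
  assumes "length \<sigma> + B * W < n"
  shows "measure_pmf.expectation (SA_run B r G \<sigma> n) (GK_value G)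
    = measure_pmf.expectation (SA_run B r G \<sigma> n) (\<lambda>s. real (gained s))"
  by (intro integral_cong_AE AE_pmfI) (auto simp: GK_value_def drained[OF assms])

end

end

subsection \<open>Offline schedules\<close>

definition class_profit :: "combined_class \<Rightarrow> offline_buffer \<Rightarrow> real" where
  "class_profit G b = (\<Sum>x\<in>#b. if in_class G (fst x) then real (profit (fst x)) else 0)"

text \<open>Unlike \<open>class_profit\<close>, this cannot jump on arrivals: a new packet has no
  progress yet, and a cycle adds at most 1.\<close>

definition class_progress :: "combined_class \<Rightarrow> offline_buffer \<Rightarrow> real" where
  "class_progress G b =
     (\<Sum>x\<in>#b. if in_class G (fst x) then real (work (fst x)) - real (snd x) else 0)"

definition offline_ok :: "nat \<Rightarrow> nat \<Rightarrow> nat \<Rightarrow> offline_buffer \<Rightarrow> bool" where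
  "offline_ok B W V b \<longleftrightarrow> size b \<le> B \<and>
     (\<forall>x\<in>#b. snd x \<le> work (fst x) \<and> work (fst x) \<in> {1..W} \<and> profit (fst x) \<in> {1..V})"

definition unfinished_mset :: "offline_buffer \<Rightarrow> offline_buffer" where
  "unfinished_mset b = filter_mset (\<lambda>(p, k). k > 0) b"

definition finished_mset :: "offline_buffer \<Rightarrow> offline_buffer" where
  "finished_mset b = filter_mset (\<lambda>(p, k). k = 0) b"

text \<open>The part of \<open>snd (S n)\<close> earned from \<open>G\<close>: the packets finished
  in \<open>S m\<close> are transmitted in cycle \<open>m\<close>.\<close>

definition class_gain :: "combined_class \<Rightarrow> (nat \<Rightarrow> offline_buffer \<times> nat) \<Rightarrow> nat \<Rightarrow> real" where
  "class_gain G S n = (\<Sum>m<n. class_profit G (finished_mset (fst (S m))))"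

lemma class_profit_simps [simp]:
  "class_profit G {#} = 0"
  "class_profit G (add_mset x b) =
     (if in_class G (fst x) then real (profit (fst x)) else 0) + class_profit G b"
  "class_profit G (b + c) = class_profit G b + class_profit G c"
  by (auto simp: class_profit_def)

lemma class_progress_simps [simp]:
  "class_progress G {#} = 0"
  "class_progress G (add_mset x b) =
     (if in_class G (fst x) then real (work (fst x)) - real (snd x) else 0) + class_progress G b"
  "class_progress G (b + c) = class_progress G b + class_progress G c"
  by (auto simp: class_progress_def)

lemma class_profit_nonneg: "0 \<le> class_profit G b"
  by (induction b) auto

lemma class_progress_nonneg:
  assumes "offline_ok B W V b"
  shows "0 \<le> class_progress G b"
proof -
  have "\<forall>x\<in>#b. snd x \<le> work (fst x)" using assms by (simp add: offline_ok_def)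
  then show ?thesis by (induction b) auto
qed

lemma finished_unfinished: "finished_mset b + unfinished_mset b = b"
proof -
  have "unfinished_mset b = filter_mset (\<lambda>x. \<not> (case x of (p, k) \<Rightarrow> k = 0)) b"
    unfolding unfinished_mset_def by (rule filter_mset_cong) auto
  then show ?thesis by (simp add: finished_mset_def flip: multiset_partition)
qed

lemma offline_ok_submset: "offline_ok B W V b \<Longrightarrow> c \<subseteq># b \<Longrightarrow> offline_ok B W V c"
  unfolding offline_ok_def by (meson mset_subset_eqD order_trans size_mset_mono)

lemma offline_arrivals_bounds:
  assumes "offline_arrivals B ps b b'" "offline_ok B W V b"
    and "\<forall>p\<in>set ps. work p \<in> {1..W} \<and> profit p \<in> {1..V}"
  shows "offline_ok B W V b' \<and> class_progress G b' \<le> class_progress G b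
    \<and> class_profit G b' \<le> class_profit G b + total_profit (filter (in_class G) ps)"
  using assms
proof induction
  case (offline_Cons b' p b ps b'')
  \<comment> \<open>\<open>c\<close> collects what is pushed out, possibly the new packet
    itself.\<close>
  obtain c where c: "add_mset (p, work p) b = b' + c"
    using offline_Cons.hyps(1) by (metis subset_mset.less_eqE)
  have all: "\<forall>x\<in>#b' + c. snd x \<le> work (fst x) \<and> work (fst x) \<in> {1..W} \<and> profit (fst x) \<in> {1..V}"
    unfolding c[symmetric] using offline_Cons.prems by (auto simp: offline_ok_def)
  then have "offline_ok B W V b'" using offline_Cons.hyps(2) by (simp add: offline_ok_def)
  moreover have "class_profit G b' + class_profit G c = class_profit G (add_mset (p, work p) b)"
    "class_progress G b' + class_progress G c = class_progress G (add_mset (p, work p) b)"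
    unfolding c by simp_all
  moreover have "0 \<le> class_progress G c"
    using all by (intro class_progress_nonneg[of "size c" W V]) (auto simp: offline_ok_def)
  moreover have "0 \<le> class_profit G c" by (rule class_profit_nonneg)
  ultimately show ?case using offline_Cons.IH offline_Cons.prems(2) by (auto split: if_splits)
qed auto

lemma offline_process_bounds:
  assumes "offline_process b b'" "offline_ok B W V b"
  shows "offline_ok B W V b' \<and> class_progress G b' \<le> class_progress G b + 1
    \<and> class_profit G b' = class_profit G b"
  using assms by induction (auto simp: offline_ok_def)

context
  fixes B W V M :: nat and \<sigma> :: arrivals and S :: "nat \<Rightarrow> offline_buffer \<times> nat"
  assumes valid: "valid_arrivals W V M \<sigma>" and schedule: "offline_schedule B \<sigma> S"
begin

lemma arrivals_at_valid:
  "\<forall>p\<in>set (arrivals_at \<sigma> n). work p \<in> {1..W} \<and> profit p \<in> {1..V}"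
  "num_U (arrivals_at \<sigma> n) \<le> M"
  using valid by (auto simp: valid_arrivals_def arrivals_at_def num_U_def)

lemma offline_step:
  obtains b where "offline_arrivals B (arrivals_at \<sigma> n) (unfinished_mset (fst (S n))) b"
    "offline_process b (fst (S (Suc n)))"
    "snd (S (Suc n)) = snd (S n) + (\<Sum>x\<in>#finished_mset (fst (S n)). profit (fst x))"
proof -
  have "offline_cycle B (arrivals_at \<sigma> n) (S n) (S (Suc n))"
    using schedule by (auto simp: offline_schedule_def)
  then show thesis
    by cases (use that in \<open>auto simp: unfinished_mset_def finished_mset_def split_def\<close>)
qed

lemma offline_ok_schedule: "offline_ok B W V (fst (S n))"
proof (induction n)
  case 0
  then show ?case using schedule by (simp add: offline_schedule_def offline_ok_def)
next
  case (Suc n)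
  have "offline_ok B W V (unfinished_mset (fst (S n)))"
    by (rule offline_ok_submset[OF Suc]) (simp add: unfinished_mset_def)
  then show ?case
    using offline_step[of n] offline_arrivals_bounds[OF _ _ arrivals_at_valid(1)]
      offline_process_bounds by metis
qed

lemma offline_step_bounds:
  "class_profit G (fst (S (Suc n))) \<le> class_profit G (unfinished_mset (fst (S n)))
     + total_profit (filter (in_class G) (arrivals_at \<sigma> n))"
  "class_progress G (fst (S (Suc n))) \<le> class_progress G (unfinished_mset (fst (S n))) + 1"
proof -
  obtain b where b: "offline_arrivals B (arrivals_at \<sigma> n) (unfinished_mset (fst (S n))) b"
    "offline_process b (fst (S (Suc n)))"
    using offline_step by metis
  have "offline_ok B W V (unfinished_mset (fst (S n)))"
    by (rule offline_ok_submset[OF offline_ok_schedule[of n]]) (simp add: unfinished_mset_def)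
  from offline_arrivals_bounds[OF b(1) this arrivals_at_valid(1), of G]
  show "class_profit G (fst (S (Suc n))) \<le> class_profit G (unfinished_mset (fst (S n)))
      + total_profit (filter (in_class G) (arrivals_at \<sigma> n))"
    "class_progress G (fst (S (Suc n))) \<le> class_progress G (unfinished_mset (fst (S n))) + 1"
    using offline_process_bounds[OF b(2), of B W V G] by auto
qed

text \<open>Instantiates \<open>offline_le_GK_value\<close>: to the gain, \<open>\<Psi>\<close> adds
  the buffered profit and \<open>D\<close> adds the buffered progress valued at
  \<open>rate\<close>.\<close>

lemma class_gain_bound:
  assumes "selected_class B M r G wlo whi vlo vhi"
  shows "class_gain G S n \<le> (real M / r + selected_class.flush_factor wlo whi vlo vhi)
    * measure_pmf.expectation (SA_run B r G \<sigma> n) (GK_value G)"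
proof -
  interpret selected_class B W M r G wlo whi vlo vhi by (rule assms)
  let ?b = "\<lambda>n. fst (S n)"
  let ?\<Psi> = "\<lambda>n. class_gain G S n + class_profit G (?b n)"
  let ?D = "\<lambda>n. class_gain G S n + rate * class_progress G (?b n)"
  have profit_le: "class_profit G b \<le> real (size b) * real vhi" for b
  proof (induction b)
    case (add x b)
    have "in_class G (fst x) \<Longrightarrow> real (profit (fst x)) \<le> real vhi"
      using profit_class[of "profit (fst x)"] by (auto simp: in_class_def)
    then show ?case using add by (auto simp: algebra_simps)
  qed simp
  have progress_le: "class_progress G b \<le> real (size b) * real whi" for b
  proof (induction b)
    case (add x b)
    have "in_class G (fst x) \<Longrightarrow> real (work (fst x)) \<le> real whi"
      using work_class[of "work (fst x)"] by (auto simp: in_class_def)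
    then show ?case using add by (auto simp: algebra_simps)
  qed simp
  \<comment> \<open>A finished packet of \<open>G\<close> has progress at least \<open>wlo\<close>,
    which at \<open>rate\<close> is worth \<open>vhi\<close>. Hence transmission does not raise
    \<open>D\<close>.\<close>
  have finished: "class_profit G (finished_mset b) \<le> rate * class_progress G (finished_mset b)" for b
  proof (induction b)
    case (add x b)
    have "real (profit (fst x)) \<le> rate * real (work (fst x))" if "in_class G (fst x)"
    proof -
      have "real (profit (fst x)) \<le> real vhi"
        using profit_class[of "profit (fst x)"] that by (auto simp: in_class_def)
      also have "\<dots> = rate * real wlo" using wlo by (simp add: rate_def)
      also have "\<dots> \<le> rate * real (work (fst x))"
        using work_class[of "work (fst x)"] that
        by (intro mult_left_mono rate_nonneg) (auto simp: in_class_def)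
      finally show ?thesis .
    qed
    then show ?case using add by (auto simp: finished_mset_def algebra_simps)
  qed (simp add: finished_mset_def)
  have split: "class_profit G b = class_profit G (finished_mset b) + class_profit G (unfinished_mset b)"
    "class_progress G b = class_progress G (finished_mset b) + class_progress G (unfinished_mset b)"
    for b
    using finished_unfinished[of b] class_profit_simps(3) class_progress_simps(3) by metis+
  have size: "real (size (?b n)) \<le> real B" for n
    using offline_ok_schedule[of n] by (simp add: offline_ok_def)
  have progress_nonneg: "0 \<le> rate * class_progress G (?b n)" for n
    using class_progress_nonneg[OF offline_ok_schedule] rate_nonneg by simp
  show ?thesis
  proof (rule offline_le_GK_value[of \<sigma> ?\<Psi> ?D])
    show "\<forall>p\<in>set (arrivals_at \<sigma> n). 0 < work p \<and> work p \<le> W" "num_U (arrivals_at \<sigma> n) \<le> M" for n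
      using arrivals_at_valid[of n] by auto
    show "?\<Psi> 0 = 0" using schedule by (simp add: class_gain_def offline_schedule_def)
    show "?\<Psi> (Suc n) \<le> ?\<Psi> n + total_profit (filter (in_class G) (arrivals_at \<sigma> n))" for n
      using offline_step_bounds(1)[of G n] split(1)[of "?b n"] by (simp add: class_gain_def)
    show "?\<Psi> n \<le> ?D n + real B * real vhi" for n
    proof -
      have "real (size (?b n)) * real vhi \<le> real B * real vhi"
        using size by (rule mult_right_mono) simp
      then show ?thesis using profit_le[of "?b n"] progress_nonneg[of n] by linarith
    qed
    show "?D (Suc n) \<le> ?D n + rate" for n
    proof -
      have "rate * class_progress G (?b (Suc n))
          \<le> rate * (class_progress G (unfinished_mset (?b n)) + 1)"
        by (rule mult_left_mono[OF offline_step_bounds(2) rate_nonneg])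
      then show ?thesis
        using finished[of "?b n"] by (simp add: class_gain_def split(2)[of "?b n"] algebra_simps)
    qed
    show "?D n \<le> ?\<Psi> n + real B * (rate * real whi)" for n
    proof -
      have "real (size (?b n)) * real whi \<le> real B * real whi"
        using size by (rule mult_right_mono) simp
      then have "rate * class_progress G (?b n) \<le> rate * (real B * real whi)"
        using progress_le[of "?b n"] by (intro mult_left_mono rate_nonneg) linarith
      then show ?thesis using class_profit_nonneg[of G "?b n"] by (simp add: algebra_simps)
    qed
    show "class_gain G S n \<le> ?\<Psi> n" using class_profit_nonneg by simp
    show "class_gain G S n \<le> ?D n" using progress_nonneg by simp
  qed
qed

text \<open>The blocks cover all work and profit values, so each transmitted packet is counted in
  some combined class.\<close>

lemma offline_gain_le_sum:
  assumes "partition_on {1..W} PW" "partition_on {1..V} PV"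
  shows "real (snd (S n)) \<le> (\<Sum>G\<in>PW \<times> PV. class_gain G S n)"
proof (induction n)
  case 0
  then show ?case using schedule by (simp add: class_gain_def offline_schedule_def)
next
  case (Suc n)
  have fin: "finite (PW \<times> PV)" using assms finite_elements by blast
  have cover: "real (\<Sum>x\<in>#b. profit (fst x)) \<le> (\<Sum>G\<in>PW \<times> PV. class_profit G b)"
    if "\<forall>x\<in>#b. work (fst x) \<in> {1..W} \<and> profit (fst x) \<in> {1..V}" for b :: offline_buffer
    using that
  proof (induction b)
    case (add x b)
    have "work (fst x) \<in> \<Union> PW" "profit (fst x) \<in> \<Union> PV"
      using add.prems partition_onD1[OF assms(1)] partition_onD1[OF assms(2)] by auto
    then obtain i j where ij: "i \<in> PW" "work (fst x) \<in> i" "j \<in> PV" "profit (fst x) \<in> j"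
      by blast
    let ?f = "\<lambda>G. if in_class G (fst x) then real (profit (fst x)) else 0"
    have "?f (i, j) \<le> (\<Sum>G\<in>PW \<times> PV. ?f G)"
      using ij fin by (intro member_le_sum) auto
    then have "real (profit (fst x)) \<le> (\<Sum>G\<in>PW \<times> PV. ?f G)"
      using ij by (simp add: in_class_def)
    then show ?case using add by (simp add: sum.distrib)
  qed simp
  have "\<forall>x\<in>#finished_mset (fst (S n)). work (fst x) \<in> {1..W} \<and> profit (fst x) \<in> {1..V}"
    using offline_ok_schedule[of n] by (auto simp: offline_ok_def finished_mset_def)
  note cover = cover[OF this]
  have "snd (S (Suc n)) = snd (S n) + (\<Sum>x\<in>#finished_mset (fst (S n)). profit (fst x))"
    using offline_step by blast
  then have "real (snd (S (Suc n)))
      = real (snd (S n)) + real (\<Sum>x\<in>#finished_mset (fst (S n)). profit (fst x))"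
    by (simp only: of_nat_add)
  also have "\<dots> \<le> (\<Sum>G\<in>PW \<times> PV. class_gain G S n)
      + (\<Sum>G\<in>PW \<times> PV. class_profit G (finished_mset (fst (S n))))"
    by (rule add_mono[OF Suc cover])
  also have "\<dots> = (\<Sum>G\<in>PW \<times> PV. class_gain G S (Suc n))"
    unfolding class_gain_def sum.lessThan_Suc sum.distrib ..
  finally show ?case .
qed

end

subsection \<open>Averaging over the classes\<close>

text \<open>The point is finiteness, without which \<open>Max\<close> says nothing: all ratios are
  quotients of numbers in \<open>{1..n}\<close>.\<close>

lemma ratio_le_max_ratio:
  assumes "partition_on {1..n} P" "A \<in> P" "x \<in> A" "y \<in> A"
  shows "real x / real y \<le> max_ratio P"
proof -
  have "{real x / real y | x y A. A \<in> P \<and> x \<in> A \<and> y \<in> A}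
      \<subseteq> (\<lambda>(x, y). real x / real y) ` ({1..n} \<times> {1..n})"
  proof
    fix q assume "q \<in> {real x / real y | x y A. A \<in> P \<and> x \<in> A \<and> y \<in> A}"
    then obtain x y A where q: "q = real x / real y" "A \<in> P" "x \<in> A" "y \<in> A" by blast
    then have "(x, y) \<in> {1..n} \<times> {1..n}" using assms(1) unfolding partition_on_def by blast
    then show "q \<in> (\<lambda>(x, y). real x / real y) ` ({1..n} \<times> {1..n})" using q(1) by force
  qed
  then have "finite {real x / real y | x y A. A \<in> P \<and> x \<in> A \<and> y \<in> A}"
    by (rule finite_subset) simp
  then show ?thesis unfolding max_ratio_def using assms(2-4) by (intro Max_ge) auto
qed

text \<open>The uniform choice of the class makes the expectation an average over all combined
  classes. This is the source of the factor \<open>card PW * card PV\<close>.\<close>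

lemma expectation_SA:
  assumes "finite PW" "PW \<noteq> {}" "finite PV" "PV \<noteq> {}"
  shows "real (card PW) * real (card PV)
      * measure_pmf.expectation (SA B r PW PV \<sigma> n) (\<lambda>s. real (gained s))
    = (\<Sum>G\<in>PW \<times> PV. measure_pmf.expectation (SA_run B r G \<sigma> n) (\<lambda>s. real (gained s)))"
proof -
  let ?e = "\<lambda>i j. measure_pmf.expectation (SA_run B r (i, j) \<sigma> n) (\<lambda>s. real (gained s))"
  have "SA B r PW PV \<sigma> n = bind_pmf (pmf_of_set PW)
      (\<lambda>i. bind_pmf (pmf_of_set PV) (\<lambda>j. SA_run B r (i, j) \<sigma> n))"
    by (simp add: SA_def pair_pmf_def bind_assoc_pmf bind_return_pmf)
  then have "measure_pmf.expectation (SA B r PW PV \<sigma> n) (\<lambda>s. real (gained s))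
      = (\<Sum>i\<in>PW. (\<Sum>j\<in>PV. ?e i j / real (card PV)) / real (card PW))"
    using assms by (simp add: pmf_expectation_bind_pmf_of_set finite_SA_run divide_inverse mult.commute)
  also have "\<dots> = (\<Sum>i\<in>PW. \<Sum>j\<in>PV. ?e i j) / (real (card PV) * real (card PW))"
    by (simp add: sum_divide_distrib)
  finally show ?thesis using assms by (simp add: sum.cartesian_product)
qed

lemma selected_class_partition:
  assumes "2 \<le> B" "1 \<le> M" "0 < r" "r \<le> 1"
    and P: "partition_on {1..W} PW" "partition_on {1..V} PV" "i \<in> PW" "j \<in> PV"
  shows "selected_class B M r (i, j) (Min i) (Max i) (Min j) (Max j)"
    "selected_class.flush_factor (Min i) (Max i) (Min j) (Max j) \<le> 4 * (max_ratio PW * max_ratio PV)"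
proof -
  have bounds: "finite A" "A \<noteq> {}" "0 < Min A" "Min A \<le> Max A"
    if "partition_on {1..n} Q" "A \<in> Q" for Q A and n :: nat
  proof -
    have "A \<subseteq> {1..n}" using that by (auto simp: partition_on_def)
    then show "finite A" by (rule finite_subset) simp
    show "A \<noteq> {}" using that by (auto simp: partition_on_def)
    have "Min A \<in> A" using \<open>finite A\<close> \<open>A \<noteq> {}\<close> by simp
    then show "0 < Min A" using \<open>A \<subseteq> {1..n}\<close> by auto
    show "Min A \<le> Max A" using \<open>Min A \<in> A\<close> \<open>finite A\<close> by simp
  qed
  note W = bounds[OF P(1,3)] and V = bounds[OF P(2,4)]
  show sel: "selected_class B M r (i, j) (Min i) (Max i) (Min j) (Max j)"
    using assms(1-4) W V by unfold_locales auto
  have "real (Max i) / real (Min i) * (real (Max j) / real (Min j)) \<le> max_ratio PW * max_ratio PV"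
    using W V ratio_le_max_ratio[OF P(1,3), of "Max i" "Min i"]
      ratio_le_max_ratio[OF P(2,4), of "Max j" "Min j"]
    by (intro mult_mono) (auto intro: order_trans[rotated])
  then show "selected_class.flush_factor (Min i) (Max i) (Min j) (Max j)
      \<le> 4 * (max_ratio PW * max_ratio PV)"
    using selected_class.flush_factor_def[OF sel] by simp
qed

lemma SA_competitive:
  assumes params: "2 \<le> B" "1 < W" "1 < V" "1 \<le> M" "0 < r" "r \<le> 1"
    and P: "partition_on {1..W} PW" "partition_on {1..V} PV"
  shows "competitive B W V M (SA_throughput B r PW PV)
    (4 * (real M / r + max_ratio PW * max_ratio PV) * real (card PW) * real (card PV))"
  unfolding competitive_def
proof (intro allI impI, elim conjE)
  fix \<sigma> S assume valid: "valid_arrivals W V M \<sigma>" and sched: "offline_schedule B \<sigma> S"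
  have fin: "finite PW" "finite PV" using P finite_elements by blast+
  have ne: "PW \<noteq> {}" "PV \<noteq> {}" using P params by (auto simp: partition_on_def)
  let ?K = "4 * (real M / r + max_ratio PW * max_ratio PV)"
  \<comment> \<open>A time from which on, for every class, the buffer is empty and the run is
    constant.\<close>
  let ?N = "Suc (length \<sigma> + B * W)"
  let ?E = "\<lambda>n. measure_pmf.expectation (SA B r PW PV \<sigma> n) (\<lambda>s. real (gained s))"
  have arr: "\<forall>p\<in>set (arrivals_at \<sigma> n). 0 < work p \<and> work p \<le> W" "num_U (arrivals_at \<sigma> n) \<le> M" for n
    using arrivals_at_valid[OF valid sched, of n] by auto
  \<comment> \<open>The online run is inspected \<open>?N\<close> cycles later than the offline
    schedule, when all secured profit has been gained.\<close>
  have class_bound: "class_gain G S n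
      \<le> ?K * measure_pmf.expectation (SA_run B r G \<sigma> (?N + n)) (\<lambda>s. real (gained s))"
    and const: "?N \<le> n \<Longrightarrow> SA_run B r G \<sigma> (Suc n) = SA_run B r G \<sigma> n"
    if "G \<in> PW \<times> PV" for G n
  proof -
    obtain i j where G: "G = (i, j)" "i \<in> PW" "j \<in> PV" using \<open>G \<in> PW \<times> PV\<close> by auto
    note sel = selected_class_partition[OF params(1,4-6) P G(2,3)]
    interpret selected_class B W M r G "Min i" "Max i" "Min j" "Max j"
      unfolding G(1) by (rule sel(1))
    have "class_gain G S n \<le> (real M / r + flush_factor)
        * measure_pmf.expectation (SA_run B r G \<sigma> n) (GK_value G)"
      using class_gain_bound[OF valid sched sel(1)] by (simp add: G(1))
    also have "\<dots> \<le> ?K * measure_pmf.expectation (SA_run B r G \<sigma> (?N + n)) (GK_value G)"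
    proof (rule mult_mono)
      have "0 \<le> real M / r" using params by simp
      then show "real M / r + flush_factor \<le> ?K" "0 \<le> ?K"
        using sel(2) flush_factor_nonneg by auto
      show "0 \<le> measure_pmf.expectation (SA_run B r G \<sigma> n) (GK_value G)"
        by (rule expectation_ge_const[OF finite_SA_run]) (simp add: GK_value_def GK_profit_nonneg)
    qed (rule GK_value_SA_run_mono[OF arr], simp)
    also have "measure_pmf.expectation (SA_run B r G \<sigma> (?N + n)) (GK_value G)
        = measure_pmf.expectation (SA_run B r G \<sigma> (?N + n)) (\<lambda>s. real (gained s))"
      by (rule GK_value_drained[OF arr]) simp
    finally show "class_gain G S n
      \<le> ?K * measure_pmf.expectation (SA_run B r G \<sigma> (?N + n)) (\<lambda>s. real (gained s))" .
    show "SA_run B r G \<sigma> (Suc n) = SA_run B r G \<sigma> n" if "?N \<le> n"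
      by (rule SA_run_constant[OF arr]) (use that in simp)
  qed
  have const_E: "?E (?N + k) = ?E ?N" for k
  proof (induction k)
    case (Suc k)
    have "real (card PW) * real (card PV) * ?E (?N + Suc k)
        = real (card PW) * real (card PV) * ?E (?N + k)"
      unfolding expectation_SA[OF fin(1) ne(1) fin(2) ne(2)]
      using const[of _ "?N + k"] by (intro sum.cong) auto
    then show ?case using Suc fin ne by simp
  qed simp
  \<comment> \<open>Boundedness for the supremum: being constant from \<open>?N\<close> on, the
    expectations take finitely many values.\<close>
  have "range ?E \<subseteq> ?E ` {..?N}"
  proof
    fix e assume "e \<in> range ?E"
    then obtain n where n: "e = ?E n" by auto
    show "e \<in> ?E ` {..?N}"
    proof (cases "n \<le> ?N")
      case False
      then have "e = ?E ?N" using n const_E[of "n - ?N"] by simp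
      then show ?thesis by blast
    qed (use n in auto)
  qed
  then have bdd: "bdd_above (range ?E)"
    by (meson bdd_above_finite bdd_above_mono finite_atMost finite_imageI)
  show "offline_throughput S \<le> ?K * real (card PW) * real (card PV) * SA_throughput B r PW PV \<sigma>"
    unfolding offline_throughput_def
  proof (rule cSUP_least)
    fix n
    have "real (snd (S n)) \<le> (\<Sum>G\<in>PW \<times> PV. class_gain G S n)"
      by (rule offline_gain_le_sum[OF valid sched P])
    also have "\<dots> \<le> (\<Sum>G\<in>PW \<times> PV.
        ?K * measure_pmf.expectation (SA_run B r G \<sigma> (?N + n)) (\<lambda>s. real (gained s)))"
      by (intro sum_mono class_bound)
    also have "\<dots> = ?K * (real (card PW) * real (card PV) * ?E (?N + n))"
      unfolding expectation_SA[OF fin(1) ne(1) fin(2) ne(2)] sum_distrib_left ..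
    also have "\<dots> \<le> ?K * (real (card PW) * real (card PV) * SA_throughput B r PW PV \<sigma>)"
    proof (intro mult_left_mono)
      show "?E (?N + n) \<le> SA_throughput B r PW PV \<sigma>"
        unfolding SA_throughput_def by (rule cSUP_upper[OF UNIV_I bdd])
      \<comment> \<open>Some class is picked as a witness that \<open>?K\<close> is
        nonnegative.\<close>
      obtain i j where ij: "i \<in> PW" "j \<in> PV" using ne by auto
      note sel = selected_class_partition[OF params(1,4-6) P ij]
      have "0 \<le> 4 * (max_ratio PW * max_ratio PV)"
        using sel(2) selected_class.flush_factor_nonneg[OF sel(1)] by linarith
      then show "0 \<le> ?K" using params by simp
    qed auto
    finally show "real (snd (S n))
        \<le> ?K * real (card PW) * real (card PV) * SA_throughput B r PW PV \<sigma>"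
      by (simp only: mult.assoc)
  qed simp
qed

theorem theorem7:
  shows "\<exists>C::real. C > 0 \<and>
    (\<forall>(B::nat) (W::nat) (V::nat) (M::nat) (r::real) (PW::nat set set) (PV::nat set set).
       B \<ge> 2 \<longrightarrow> W > 1 \<longrightarrow> V > 1 \<longrightarrow> M \<ge> 1 \<longrightarrow> 0 < r \<longrightarrow> r \<le> 1 \<longrightarrow>
       partition_on {1..W} PW \<longrightarrow> partition_on {1..V} PV \<longrightarrow>
       competitive B W V M (SA_throughput B r PW PV)
         (C * (real M / r + max_ratio PW * max_ratio PV) * real (card PW) * real (card PV)))"
  by (rule exI[of _ 4]) (use SA_competitive in simp)

end
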